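(* Set $h_{-n}=\lim_{M\rightarrow \infty}\bar{\wedge}_n$ and $h_n=\lim_{M\rightarrow \infty}\bar{\wedge}^*_n$ for $n\ge 1$, where $\bar{\wedge}_n=\sum_{i=-\infty}^M\varphi_{-i}\varphi^*_{i-n}$ and $\bar{\wedge}^*_n=\sum_{i=-\infty}^M\varphi_{-i+n}\varphi^*_{i}$. Then for all nonzero integers $m,n$ $$[h_m,h_n]=-m\,\delta_{m,-n},$$ and $$\lim_{M\rightarrow \infty}\mathbf{B}^{*}(x)=\exp\left(\sum^{\infty}_{n=1}\frac{(-1)^{n+1}}{n}x^nh_{-n}\right),\qquad \lim_{M\rightarrow \infty}\mathbf{C}^{*}(x)=\exp\left(\sum^{\infty}_{n=1}\frac{(-1)^{n+1}}{n}x^nh_n\right),$$ $$\lim_{M\rightarrow \infty}\mathbf{C}^{*}(x)\mathbf{B}^{*}(y)=(1-xy)\lim_{M\rightarrow \infty}\mathbf{B}^{*}(y)\mathbf{C}^{*}(x).$$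
   Context: The charged free bosons $\varphi_i,\varphi^*_i$ ($i\in\mathbb Z$) satisfy $[\varphi_i,\varphi^*_j]=\delta_{i,-j}$, $[\varphi_i,\varphi_j]=[\varphi^*_i,\varphi^*_j]=0$. They act on the Fock space $\mathcal M$ generated by $|0\rangle$ with $\varphi_i|0\rangle=\varphi^*_{i+1}|0\rangle=0$ for $i\ge0$. For a positive integer $M$, $$\mathbf B^*(x)=\exp(x\varphi_{-M}\varphi^*_{M-1})\exp(x\varphi_{-M+1}\varphi^*_{M-2})\cdots,\qquad \mathbf C^*(x)=\cdots\exp(x\varphi_{-M+2}\varphi^*_{M-1})\exp(x\varphi_{-M+1}\varphi^*_{M}),$$ i.e. the ordered products of $\exp(x\varphi_{-i}\varphi^*_{i-1})$ ($i\le M$, $i$ decreasing from left to right) and of $\exp(x\varphi_{-i+1}\varphi^*_{i})$ ($i\le M$, $i$ decreasing from right to left). These are viewed as formal power series in $x$ with operator coefficients; on each fixed vector only finitely many terms contribute to each power of $x$. Limits $M\to\infty$ are taken coefficientwise in $x,y$ and pointwise on vectors of $\mathcal M$ (the values stabilize). *)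

theory Defs
  imports Complex_Main "HOL-Library.Poly_Mapping" "HOL-Library.Multiset"
begin

section \<open>Charged free bosons and their Fock space\<close>

definition commutator :: "('v \<Rightarrow> 'v) \<Rightarrow> ('v \<Rightarrow> 'v) \<Rightarrow> 'v \<Rightarrow> 'v::ab_group_add"
  where "commutator A B = (\<lambda>v. A (B v) - B (A v))"

text \<open>
  A Fock space is a vector space over a field of characteristic 0 with operators
  \<^term>\<open>phi i\<close> ($\varphi_i$) and \<^term>\<open>phis i\<close> ($\varphi^*_i$), generated under these operators
  by a nonzero vacuum. These conditions determine it up to isomorphism, because the Fock
  representation of the Weyl algebra is simple; the end of this theory constructs the
  polynomial model.
\<close>

locale charged_free_bosons = vector_space scale
  for scale :: "'a::field_char_0 \<Rightarrow> 'v::ab_group_add \<Rightarrow> 'v" +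
  fixes phi phis :: "int \<Rightarrow> 'v \<Rightarrow> 'v" and vac :: 'v
  assumes linear_phi: "Vector_Spaces.linear scale scale (phi i)"
    and linear_phis: "Vector_Spaces.linear scale scale (phis i)"
    and comm_phi_phis:
      "commutator (phi i) (phis j) = (\<lambda>v. scale (if i = - j then 1 else 0) v)"
    and comm_phi_phi: "commutator (phi i) (phi j) = (\<lambda>v. 0)"
    and comm_phis_phis: "commutator (phis i) (phis j) = (\<lambda>v. 0)"
    and vac_nonzero: "vac \<noteq> 0"
    and phi_vac: "i \<ge> 0 \<Longrightarrow> phi i vac = 0"
    and phis_vac: "i \<ge> 0 \<Longrightarrow> phis (i + 1) vac = 0"
    and generated_by_vac:
      "subspace W \<Longrightarrow> vac \<in> W \<Longrightarrow> (\<And>i w. w \<in> W \<Longrightarrow> phi i w \<in> W)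
        \<Longrightarrow> (\<And>i w. w \<in> W \<Longrightarrow> phis i w \<in> W) \<Longrightarrow> W = UNIV"


section \<open>Limits of stabilizing sequences\<close>

definition stabilizes :: "(nat \<Rightarrow> 'b) \<Rightarrow> bool"
  where "stabilizes f \<longleftrightarrow> (\<exists>l. \<forall>\<^sub>F n in sequentially. f n = l)"

text \<open>Unspecified if the sequence does not stabilize.\<close>

definition stable_lim :: "(nat \<Rightarrow> 'b) \<Rightarrow> 'b"
  where "stable_lim f = (THE l. \<forall>\<^sub>F n in sequentially. f n = l)"

definition op_stabilizes :: "(nat \<Rightarrow> 'v \<Rightarrow> 'v) \<Rightarrow> bool"
  where "op_stabilizes T \<longleftrightarrow> (\<forall>v. stabilizes (\<lambda>n. T n v))"

definition op_lim :: "(nat \<Rightarrow> 'v \<Rightarrow> 'v) \<Rightarrow> 'v \<Rightarrow> 'v"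
  where "op_lim T = (\<lambda>v. stable_lim (\<lambda>n. T n v))"

text \<open>
  A formal power series with operator coefficients is the family of its coefficients, indexed by
  exponents: \<^typ>\<open>nat\<close> for one variable, \<^typ>\<open>nat \<times> nat\<close> for two. Limits are
  coefficientwise.
\<close>

definition series_stabilizes :: "(nat \<Rightarrow> 'i \<Rightarrow> 'v \<Rightarrow> 'v) \<Rightarrow> bool"
  where "series_stabilizes F \<longleftrightarrow> (\<forall>k. op_stabilizes (\<lambda>n. F n k))"

definition series_lim :: "(nat \<Rightarrow> 'i \<Rightarrow> 'v \<Rightarrow> 'v) \<Rightarrow> 'i \<Rightarrow> 'v \<Rightarrow> 'v"
  where "series_lim F = (\<lambda>k. op_lim (\<lambda>n. F n k))"


section \<open>Formal power series with operator coefficients\<close>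

type_synonym 'v opser = "nat \<Rightarrow> 'v \<Rightarrow> 'v"

definition opser_one :: "('v::ab_group_add) opser"
  where "opser_one = (\<lambda>n v. if n = 0 then v else 0)"

definition opser_mult :: "('v::ab_group_add) opser \<Rightarrow> 'v opser \<Rightarrow> 'v opser"
  where "opser_mult F G = (\<lambda>n v. \<Sum>k\<le>n. F k (G (n - k) v))"

definition opser_power :: "('v::ab_group_add) opser \<Rightarrow> nat \<Rightarrow> 'v opser"
  where "opser_power F k = (opser_mult F ^^ k) opser_one"

definition opser_prod_list :: "('v::ab_group_add) opser list \<Rightarrow> 'v opser"
  where "opser_prod_list Fs = foldr opser_mult Fs opser_one"

text \<open>
  \<open>\<Sum>k. F^k / k!\<close>, meant for series \<open>F\<close> with zero constant term: then the coefficient of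
  \<open>x^n\<close> in \<open>F^k\<close> vanishes for \<open>k > n\<close>, which is why the sum stops at \<open>n\<close>.
\<close>

definition opser_exp ::
    "('a::field_char_0 \<Rightarrow> 'v::ab_group_add \<Rightarrow> 'v) \<Rightarrow> 'v opser \<Rightarrow> 'v opser"
  where "opser_exp scale F = (\<lambda>n v. \<Sum>k\<le>n. scale (1 / fact k) (opser_power F k n v))"

text \<open>The series \<open>x A\<close>.\<close>

definition opser_x_times :: "('v \<Rightarrow> 'v) \<Rightarrow> ('v::ab_group_add) opser"
  where "opser_x_times A = (\<lambda>n v. if n = 1 then A v else 0)"

text \<open>
  \<open>F(x) G(y)\<close> and \<open>G(y) F(x)\<close> as series in \<open>x\<close> and \<open>y\<close>; the pair \<open>(a, b)\<close> stands for
  \<open>x^a y^b\<close> in both.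
\<close>

definition opser_mult_xy :: "'v opser \<Rightarrow> 'v opser \<Rightarrow> nat \<times> nat \<Rightarrow> 'v \<Rightarrow> 'v"
  where "opser_mult_xy F G = (\<lambda>(a, b) v. F a (G b v))"

definition opser_mult_yx :: "'v opser \<Rightarrow> 'v opser \<Rightarrow> nat \<times> nat \<Rightarrow> 'v \<Rightarrow> 'v"
  where "opser_mult_yx G F = (\<lambda>(a, b) v. G b (F a v))"

text \<open>The product \<open>(1 - x y) P(x, y)\<close>.\<close>

definition one_minus_xy_times ::
    "(nat \<times> nat \<Rightarrow> 'v \<Rightarrow> 'v) \<Rightarrow> nat \<times> nat \<Rightarrow> 'v \<Rightarrow> 'v::ab_group_add"
  where "one_minus_xy_times P =
    (\<lambda>(a, b) v. P (a, b) v - (if a = 0 \<or> b = 0 then 0 else P (a - 1, b - 1) v))"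


section \<open>The operators\<close>

text \<open>
  Sums over \<open>i \<le> M\<close> are limits of the sums over \<open>- L \<le> i \<le> M\<close> as \<open>L \<rightarrow> \<infinity>\<close>.
\<close>

definition wedge_partial ::
    "(int \<Rightarrow> 'v \<Rightarrow> 'v) \<Rightarrow> (int \<Rightarrow> 'v \<Rightarrow> 'v) \<Rightarrow> int \<Rightarrow> int \<Rightarrow> nat \<Rightarrow> 'v \<Rightarrow> 'v::ab_group_add"
  where "wedge_partial phi phis n M L = (\<lambda>v. \<Sum>i\<in>{- int L..M}. phi (- i) (phis (i - n) v))"

definition wedge ::
    "(int \<Rightarrow> 'v \<Rightarrow> 'v) \<Rightarrow> (int \<Rightarrow> 'v \<Rightarrow> 'v) \<Rightarrow> int \<Rightarrow> int \<Rightarrow> 'v \<Rightarrow> 'v::ab_group_add"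
  where "wedge phi phis n M = op_lim (wedge_partial phi phis n M)"

definition wedge_star_partial ::
    "(int \<Rightarrow> 'v \<Rightarrow> 'v) \<Rightarrow> (int \<Rightarrow> 'v \<Rightarrow> 'v) \<Rightarrow> int \<Rightarrow> int \<Rightarrow> nat \<Rightarrow> 'v \<Rightarrow> 'v::ab_group_add"
  where "wedge_star_partial phi phis n M L =
    (\<lambda>v. \<Sum>i\<in>{- int L..M}. phi (- i + n) (phis i v))"

definition wedge_star ::
    "(int \<Rightarrow> 'v \<Rightarrow> 'v) \<Rightarrow> (int \<Rightarrow> 'v \<Rightarrow> 'v) \<Rightarrow> int \<Rightarrow> int \<Rightarrow> 'v \<Rightarrow> 'v::ab_group_add"
  where "wedge_star phi phis n M = op_lim (wedge_star_partial phi phis n M)"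

text \<open>Only the values at nonzero \<open>m\<close> are meaningful.\<close>

definition h_op ::
    "(int \<Rightarrow> 'v \<Rightarrow> 'v) \<Rightarrow> (int \<Rightarrow> 'v \<Rightarrow> 'v) \<Rightarrow> int \<Rightarrow> 'v \<Rightarrow> 'v::ab_group_add"
  where "h_op phi phis m =
    (if m < 0 then op_lim (\<lambda>M. wedge phi phis (- m) (int M))
     else op_lim (\<lambda>M. wedge_star phi phis m (int M)))"

text \<open>
  The infinite ordered products are limits of the products of their first \<open>L\<close> factors, those with
  \<open>i = M, M - 1, \<dots>, M - L + 1\<close>. The index decreases from left to right in \<open>B*\<close> and from right
  to left in \<open>C*\<close>.
\<close>

definition B_star_partial ::
    "('a::field_char_0 \<Rightarrow> 'v \<Rightarrow> 'v) \<Rightarrow> (int \<Rightarrow> 'v \<Rightarrow> 'v) \<Rightarrow> (int \<Rightarrow> 'v \<Rightarrow> 'v) \<Rightarrow>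
      int \<Rightarrow> nat \<Rightarrow> ('v::ab_group_add) opser"
  where "B_star_partial scale phi phis M L =
    opser_prod_list
      (map (\<lambda>k. let i = M - int k in
              opser_exp scale (opser_x_times (phi (- i) \<circ> phis (i - 1)))) [0..<L])"

definition B_star ::
    "('a::field_char_0 \<Rightarrow> 'v \<Rightarrow> 'v) \<Rightarrow> (int \<Rightarrow> 'v \<Rightarrow> 'v) \<Rightarrow> (int \<Rightarrow> 'v \<Rightarrow> 'v) \<Rightarrow>
      int \<Rightarrow> ('v::ab_group_add) opser"
  where "B_star scale phi phis M = series_lim (B_star_partial scale phi phis M)"

definition C_star_partial ::
    "('a::field_char_0 \<Rightarrow> 'v \<Rightarrow> 'v) \<Rightarrow> (int \<Rightarrow> 'v \<Rightarrow> 'v) \<Rightarrow> (int \<Rightarrow> 'v \<Rightarrow> 'v) \<Rightarrow>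
      int \<Rightarrow> nat \<Rightarrow> ('v::ab_group_add) opser"
  where "C_star_partial scale phi phis M L =
    opser_prod_list
      (map (\<lambda>k. let i = M - int k in
              opser_exp scale (opser_x_times (phi (- i + 1) \<circ> phis i))) (rev [0..<L]))"

definition C_star ::
    "('a::field_char_0 \<Rightarrow> 'v \<Rightarrow> 'v) \<Rightarrow> (int \<Rightarrow> 'v \<Rightarrow> 'v) \<Rightarrow> (int \<Rightarrow> 'v \<Rightarrow> 'v) \<Rightarrow>
      int \<Rightarrow> ('v::ab_group_add) opser"
  where "C_star scale phi phis M = series_lim (C_star_partial scale phi phis M)"

text \<open>
  The series \<open>\<Sum>n\<ge>1. ((- 1)^(n + 1) / n) x^n H n\<close>.
\<close>

definition log_series ::
    "('a::field_char_0 \<Rightarrow> 'v \<Rightarrow> 'v) \<Rightarrow> (nat \<Rightarrow> 'v \<Rightarrow> 'v) \<Rightarrow> ('v::ab_group_add) opser"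
  where "log_series scale H =
    (\<lambda>n v. if n = 0 then 0 else scale ((- 1) ^ (n + 1) / of_nat n) (H n v))"


section \<open>The inner limits exist\<close>

lemma stabilizesI: "(\<And>n. n \<ge> N \<Longrightarrow> f n = l) \<Longrightarrow> stabilizes f"
  unfolding stabilizes_def eventually_sequentially by blast

lemma stabilizesI_Suc:
  assumes "\<And>n. n \<ge> N \<Longrightarrow> f (Suc n) = f n"
  shows "stabilizes f"
proof (rule stabilizesI)
  fix n assume "n \<ge> N"
  then show "f n = f N"
    by (induction rule: dec_induct) (use assms in auto)
qed

lemma stabilizes_sum:
  fixes f :: "int \<Rightarrow> 'v::ab_group_add"
  assumes "\<And>i. i < - N \<Longrightarrow> f i = 0"
  shows "stabilizes (\<lambda>L. \<Sum>i\<in>{- int L..M}. f i)"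
proof (rule stabilizesI)
  fix L assume "nat N \<le> L"
  then show "(\<Sum>i\<in>{- int L..M}. f i) = (\<Sum>i\<in>{- int (nat N)..M}. f i)"
    by (intro sum.mono_neutral_right) (auto intro: assms)
qed

lemma opser_mult_x_times:
  assumes "X 0 = 0"
  shows "opser_mult (opser_x_times X) G n v = (case n of 0 \<Rightarrow> 0 | Suc m \<Rightarrow> X (G m v))"
proof -
  have "opser_mult (opser_x_times X) G n v = (\<Sum>k\<le>n. if k = 1 then X (G (n - k) v) else 0)"
    unfolding opser_mult_def opser_x_times_def by (rule sum.cong) auto
  also have "\<dots> = (case n of 0 \<Rightarrow> 0 | Suc m \<Rightarrow> X (G m v))"
    by (cases n) auto
  finally show ?thesis .
qed

lemma opser_power_x_times:
  assumes "X 0 = 0"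
  shows "opser_power (opser_x_times X) k n v = (if n = k then (X ^^ k) v else 0)"
  unfolding opser_power_def
proof (induction k arbitrary: n)
  case 0
  then show ?case by (simp add: opser_one_def)
next
  case (Suc k)
  then show ?case by (cases n) (simp_all add: opser_mult_x_times[of X, OF assms] assms)
qed

lemma foldr_opser_mult_cong:
  assumes "\<And>n. F n v = G n v"
  shows "foldr opser_mult Fs F n v = foldr opser_mult Fs G n v"
  by (induction Fs arbitrary: n) (auto simp: opser_mult_def assms)

context charged_free_bosons
begin

lemma opser_exp_x_times:
  assumes "X 0 = 0"
  shows "opser_exp scale (opser_x_times X) n v = scale (1 / fact n) ((X ^^ n) v)"
proof -
  have "opser_exp scale (opser_x_times X) n v =
      (\<Sum>k\<le>n. if k = n then scale (1 / fact n) ((X ^^ n) v) else 0)"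
    unfolding opser_exp_def opser_power_x_times[of X, OF assms] by (rule sum.cong) auto
  then show ?thesis by simp
qed

lemma opser_exp_x_times_0:
  assumes "X 0 = 0" "X v = 0"
  shows "opser_exp scale (opser_x_times X) n v = opser_one n v"
proof -
  have "(X ^^ Suc m) v = 0" for m
    by (induction m) (auto simp: assms)
  then show ?thesis
    by (cases n) (auto simp: opser_exp_x_times[of X, OF assms(1)] opser_one_def
        simp del: funpow.simps)
qed

text \<open>Infinite products, to the right and to the left, of exponentials of operators that vanish on
  any fixed vector from some index on.\<close>

lemma stabilizes_prod_right:
  assumes "\<And>k. X k 0 = 0" and "\<And>k. k \<ge> K \<Longrightarrow> X k v = 0"
  shows "stabilizes (\<lambda>L. opser_prod_list
    (map (\<lambda>k. opser_exp scale (opser_x_times (X k))) [0..<L]) n v)"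
proof (rule stabilizesI_Suc)
  fix L assume "K \<le> L"
  have "opser_mult (opser_exp scale (opser_x_times (X L))) opser_one n v = opser_one n v" for n
  proof -
    have "opser_mult (opser_exp scale (opser_x_times (X L))) opser_one n v =
      (\<Sum>k\<le>n. if k = n then opser_exp scale (opser_x_times (X L)) n v else 0)"
      unfolding opser_mult_def
    proof (rule sum.cong[OF refl])
      fix k assume "k \<in> {..n}"
      moreover have "opser_exp scale (opser_x_times (X L)) k 0 = 0"
        by (subst opser_exp_x_times_0) (auto simp: assms opser_one_def)
      ultimately show "opser_exp scale (opser_x_times (X L)) k (opser_one (n - k) v) =
          (if k = n then opser_exp scale (opser_x_times (X L)) n v else 0)"
        by (auto simp: opser_one_def)
    qed
    also have "\<dots> = opser_one n v"
      using \<open>K \<le> L\<close> by (simp add: opser_exp_x_times_0 assms)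
    finally show ?thesis .
  qed
  then show "opser_prod_list (map (\<lambda>k. opser_exp scale (opser_x_times (X k))) [0..<Suc L]) n v =
      opser_prod_list (map (\<lambda>k. opser_exp scale (opser_x_times (X k))) [0..<L]) n v"
    unfolding opser_prod_list_def by (simp, intro foldr_opser_mult_cong)
qed

lemma stabilizes_prod_left:
  assumes X0: "\<And>k. X k 0 = 0" and fin: "\<And>v. \<exists>K. \<forall>k\<ge>K. X k v = 0"
  shows "stabilizes (\<lambda>L. opser_prod_list
    (map (\<lambda>k. opser_exp scale (opser_x_times (X k))) (rev [0..<L])) n v)"
proof -
  define E where "E k = opser_exp scale (opser_x_times (X k))" for k
  define P where "P L = opser_prod_list (map E (rev [0..<L]))" for L
  have P_Suc: "P (Suc L) n v = (\<Sum>k\<le>n. E L k (P L (n - k) v))" for L n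
    by (simp add: P_def opser_prod_list_def opser_mult_def)
  have "\<exists>K. \<forall>L\<ge>K. P (Suc L) n v = P L n v"
  proof (induction n rule: less_induct)
    case (less n)
    have "\<exists>K. \<forall>L\<ge>K. X L (P L m v) = 0" if "m < n" for m
    proof -
      from less[OF that] obtain K where K: "\<And>L. L \<ge> K \<Longrightarrow> P (Suc L) m v = P L m v" by blast
      have eq: "P L m v = P K m v" if "L \<ge> K" for L
        using that by (induction rule: dec_induct) (use K in auto)
      obtain K' where "\<And>k. k \<ge> K' \<Longrightarrow> X k (P K m v) = 0" using fin by blast
      then have "X L (P L m v) = 0" if "L \<ge> max K K'" for L
        using that by (subst eq) auto
      then show ?thesis by blast
    qed
    then obtain Kf where Kf: "\<And>m L. m < n \<Longrightarrow> L \<ge> Kf m \<Longrightarrow> X L (P L m v) = 0" by metis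
    define K where "K = (\<Sum>m<n. Kf m)"
    have "P (Suc L) n v = P L n v" if "L \<ge> K" for L
    proof -
      have le: "Kf m \<le> L" if "m < n" for m
        using member_le_sum[of m "{..<n}" Kf] \<open>L \<ge> K\<close> that by (auto simp: K_def)
      have "P (Suc L) n v = (\<Sum>k\<le>n. if k = 0 then P L n v else 0)"
        unfolding P_Suc
      proof (rule sum.cong[OF refl])
        fix k assume "k \<in> {..n}"
        show "E L k (P L (n - k) v) = (if k = 0 then P L n v else 0)"
        proof (cases "k = 0")
          case True
          then show ?thesis unfolding E_def by (simp add: opser_exp_x_times[of "X L", OF X0])
        next
          case False
          with \<open>k \<in> {..n}\<close> have "X L (P L (n - k) v) = 0" by (intro Kf le) auto
          with False show ?thesis
            unfolding E_def by (simp add: opser_exp_x_times_0 X0) (simp add: opser_one_def)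
        qed
      qed
      then show ?thesis by simp
    qed
    then show ?case by blast
  qed
  then obtain K where "\<And>L. L \<ge> K \<Longrightarrow> P (Suc L) n v = P L n v" by blast
  then have "stabilizes (\<lambda>L. P L n v)" by (rule stabilizesI_Suc)
  then show ?thesis unfolding P_def E_def .
qed

lemma phi_add: "phi i (v + w) = phi i v + phi i w"
  and phis_add: "phis i (v + w) = phis i v + phis i w"
  and phi_scale: "phi i (scale c v) = scale c (phi i v)"
  and phis_scale: "phis i (scale c v) = scale c (phis i v)"
  using linear_phi linear_phis by (simp_all add: Vector_Spaces.linear_iff)

lemma phi_0 [simp]: "phi i 0 = 0" and phis_0 [simp]: "phis i 0 = 0"
  using phi_scale[of i 0 0] phis_scale[of i 0 0] by simp_all

lemma phi_phis: "phi i (phis j v) = phis j (phi i v) + scale (if i = - j then 1 else 0) v"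
  using fun_cong[OF comm_phi_phis[of i j], of v] by (simp add: commutator_def algebra_simps)

lemma phi_phi: "phi i (phi j v) = phi j (phi i v)"
  using fun_cong[OF comm_phi_phi[of i j], of v] by (simp add: commutator_def)

lemma phis_phis: "phis i (phis j v) = phis j (phis i v)"
  using fun_cong[OF comm_phis_phis[of i j], of v] by (simp add: commutator_def)

lemma annihilated: "\<exists>N. \<forall>i\<ge>N. phi i v = 0 \<and> phis i v = 0"
proof -
  define W where "W = {v. \<exists>N. \<forall>i\<ge>N. phi i v = 0 \<and> phis i v = 0}"
  have "W = UNIV"
  proof (rule generated_by_vac)
    show "subspace W"
    proof (rule subspaceI)
      show "0 \<in> W" by (simp add: W_def)
    next
      fix x y assume "x \<in> W" "y \<in> W"
      then obtain N1 N2 where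
        "\<And>i. i \<ge> N1 \<Longrightarrow> phi i x = 0 \<and> phis i x = 0"
        "\<And>i. i \<ge> N2 \<Longrightarrow> phi i y = 0 \<and> phis i y = 0" unfolding W_def by blast
      then have "\<forall>i\<ge>max N1 N2. phi i (x + y) = 0 \<and> phis i (x + y) = 0"
        by (simp add: phi_add phis_add)
      then show "x + y \<in> W" unfolding W_def by blast
    next
      fix c x assume "x \<in> W"
      then show "scale c x \<in> W"
        unfolding W_def by (auto simp: phi_scale phis_scale)
    qed
    have "phis i vac = 0" if "i \<ge> 1" for i
      using phis_vac[of "i - 1"] that by simp
    then show "vac \<in> W"
      unfolding W_def using phi_vac by (intro CollectI exI[of _ 1]) auto
  next
    fix j w assume "w \<in> W"
    then obtain N where N: "\<And>i. i \<ge> N \<Longrightarrow> phi i w = 0 \<and> phis i w = 0" unfolding W_def by blast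
    have "phi i (phi j w) = 0 \<and> phis i (phi j w) = 0" if "i \<ge> max N (1 - j)" for i
      using N[of i] that phi_phi[of i j w] phi_phis[of j i w] by auto
    then show "phi j w \<in> W" unfolding W_def by blast
    have "phi i (phis j w) = 0 \<and> phis i (phis j w) = 0" if "i \<ge> max N (1 - j)" for i
      using N[of i] that phis_phis[of i j w] phi_phis[of i j w] by auto
    then show "phis j w \<in> W" unfolding W_def by blast
  qed
  then show ?thesis unfolding W_def by blast
qed

lemma phi_phis_eventually_0:
  assumes "n \<noteq> 0"
  shows "\<exists>N\<ge>0. \<forall>i\<le>- N. phi (- i) (phis (i - n) v) = 0"
proof -
  obtain N where N: "\<And>i. i \<ge> N \<Longrightarrow> phi i v = 0" using annihilated by blast
  then have "\<forall>i\<le>- max 0 N. phi (- i) (phis (i - n) v) = 0"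
    using assms by (simp add: phi_phis)
  then show ?thesis by (intro exI[of _ "max 0 N"]) simp
qed

lemma wedge_partial_stabilizes:
  assumes "n \<noteq> 0"
  shows "op_stabilizes (wedge_partial phi phis n M)"
  unfolding op_stabilizes_def wedge_partial_def
proof
  fix v
  obtain N where "\<And>i. i \<le> - N \<Longrightarrow> phi (- i) (phis (i - n) v) = 0"
    using phi_phis_eventually_0[OF assms] by blast
  then show "stabilizes (\<lambda>L. \<Sum>i\<in>{- int L..M}. phi (- i) (phis (i - n) v))"
    by (intro stabilizes_sum[of N]) auto
qed

lemma wedge_star_partial_stabilizes:
  assumes "n \<noteq> 0"
  shows "op_stabilizes (wedge_star_partial phi phis n M)"
  unfolding op_stabilizes_def wedge_star_partial_def
proof
  fix v
  obtain N where N: "\<And>i. i \<le> - N \<Longrightarrow> phi (- i) (phis (i - (- n)) v) = 0"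
    using phi_phis_eventually_0[of "- n" v] assms neg_equal_0_iff_equal by metis
  have "phi (- i + n) (phis i v) = 0" if "i < - (N + \<bar>n\<bar>)" for i
    using N[of "i - n"] that by (simp add: algebra_simps)
  then show "stabilizes (\<lambda>L. \<Sum>i\<in>{- int L..M}. phi (- i + n) (phis i v))"
    by (rule stabilizes_sum)
qed

lemma B_star_partial_stabilizes: "series_stabilizes (B_star_partial scale phi phis M)"
  unfolding series_stabilizes_def op_stabilizes_def B_star_partial_def Let_def
proof (intro allI)
  fix n v
  define X where "X k = phi (- (M - int k)) \<circ> phis (M - int k - 1)" for k
  obtain N where N: "\<And>i. i \<le> - N \<Longrightarrow> phi (- i) (phis (i - 1) v) = 0"
    using phi_phis_eventually_0[of 1 v] zero_neq_one by metis
  have Xv: "X k v = 0" if "k \<ge> nat (M + N)" for k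
    unfolding X_def comp_apply using that by (intro N) linarith
  have X0: "X k 0 = 0" for k
    by (simp add: X_def)
  from X0 Xv have "stabilizes (\<lambda>L. opser_prod_list
      (map (\<lambda>k. opser_exp scale (opser_x_times (X k))) [0..<L]) n v)"
    by (rule stabilizes_prod_right)
  then show "stabilizes (\<lambda>L. opser_prod_list (map (\<lambda>k. opser_exp scale
      (opser_x_times (phi (- (M - int k)) \<circ> phis (M - int k - 1)))) [0..<L]) n v)"
    unfolding X_def .
qed

lemma C_star_partial_stabilizes: "series_stabilizes (C_star_partial scale phi phis M)"
  unfolding series_stabilizes_def op_stabilizes_def C_star_partial_def Let_def
proof (intro allI)
  fix n v
  define X where "X k = phi (- (M - int k) + 1) \<circ> phis (M - int k)" for k
  have Xv: "\<exists>K. \<forall>k\<ge>K. X k v = 0" for v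
  proof -
    obtain N where N: "\<And>i. i \<le> - N \<Longrightarrow> phi (- i) (phis (i - (- 1)) v) = 0"
      using phi_phis_eventually_0[of "- 1" v] zero_neq_neg_one by metis
    have "X k v = 0" if "k \<ge> nat (M + N)" for k
    proof -
      have "M - int k - 1 \<le> - N" using that by linarith
      from N[OF this] show ?thesis by (simp add: X_def algebra_simps)
    qed
    then show ?thesis by blast
  qed
  have X0: "X k 0 = 0" for k
    by (simp add: X_def)
  from X0 Xv have "stabilizes (\<lambda>L. opser_prod_list
      (map (\<lambda>k. opser_exp scale (opser_x_times (X k))) (rev [0..<L])) n v)"
    by (rule stabilizes_prod_left)
  then show "stabilizes (\<lambda>L. opser_prod_list (map (\<lambda>k. opser_exp scale
      (opser_x_times (phi (- (M - int k) + 1) \<circ> phis (M - int k)))) (rev [0..<L])) n v)"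
    unfolding X_def .
qed

end


section \<open>The polynomial model\<close>

text \<open>
  Polynomials in variables \<open>z k\<close>, \<open>k\<close> an integer, with monomials as multisets of indices:
  \<open>z k\<close> is $\varphi_k$ for \<open>k < 0\<close> and $\varphi^*_{-k}$ for \<open>k \<ge> 0\<close>.
\<close>

type_synonym 'a fock = "int multiset \<Rightarrow>\<^sub>0 'a"

lift_definition fock_scale :: "'a::field_char_0 \<Rightarrow> 'a fock \<Rightarrow> 'a fock"
  is "\<lambda>c f m. c * f m"
  by (auto elim: finite_subset[rotated])

lift_definition fock_mult :: "int \<Rightarrow> 'a fock \<Rightarrow> 'a::field_char_0 fock"
  is "\<lambda>k f m. if k \<in># m then f (m - {#k#}) else 0"
proof -
  fix k and f :: "int multiset \<Rightarrow> 'a"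
  assume fin: "finite {m. f m \<noteq> 0}"
  have "{m. (if k \<in># m then f (m - {#k#}) else 0) \<noteq> 0} \<subseteq> add_mset k ` {m. f m \<noteq> 0}"
    by (auto simp: image_iff split: if_splits) (metis insert_DiffM)
  with fin show "finite {m. (if k \<in># m then f (m - {#k#}) else 0) \<noteq> 0}"
    by (meson finite_imageI finite_subset)
qed

lift_definition fock_deriv :: "int \<Rightarrow> 'a fock \<Rightarrow> 'a::field_char_0 fock"
  is "\<lambda>k f m. of_nat (count m k + 1) * f (add_mset k m)"
proof -
  fix k and f :: "int multiset \<Rightarrow> 'a"
  assume fin: "finite {m. f m \<noteq> 0}"
  have "{m. of_nat (count m k + 1) * f (add_mset k m) \<noteq> 0} \<subseteq> (\<lambda>m. m - {#k#}) ` {m. f m \<noteq> 0}"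
    by (auto simp: image_iff) (metis add_mset_remove_trivial)
  with fin show "finite {m. of_nat (count m k + 1) * f (add_mset k m) \<noteq> 0}"
    by (meson finite_imageI finite_subset)
qed

definition fock_phi :: "int \<Rightarrow> 'a fock \<Rightarrow> 'a::field_char_0 fock"
  where "fock_phi i = (if i < 0 then fock_mult i else fock_deriv i)"

definition fock_phis :: "int \<Rightarrow> 'a fock \<Rightarrow> 'a::field_char_0 fock"
  where "fock_phis i = (if i \<le> 0 then fock_mult (- i) else (\<lambda>f. - fock_deriv (- i) f))"

definition fock_vac :: "'a::field_char_0 fock"
  where "fock_vac = Poly_Mapping.single {#} 1"

lemma fock_mult_mult: "fock_mult k (fock_mult l f) = fock_mult l (fock_mult k f)"
  by (transfer, rule ext) (auto simp: in_diff_count diff_diff_add_mset add_mset_commute)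

lemma fock_deriv_deriv: "fock_deriv k (fock_deriv l f) = fock_deriv l (fock_deriv k f)"
  by (transfer, rule ext) (auto simp: add_mset_commute)

lemma fock_deriv_mult:
  "fock_deriv k (fock_mult l f) = fock_mult l (fock_deriv k f) + (if k = l then f else 0)"
proof (rule poly_mapping_eqI)
  fix m
  show "Poly_Mapping.lookup (fock_deriv k (fock_mult l f)) m =
      Poly_Mapping.lookup (fock_mult l (fock_deriv k f) + (if k = l then f else 0)) m"
  proof (cases "l \<in># m")
    case True
    then obtain m' where m: "m = add_mset l m'" by (metis insert_DiffM)
    show ?thesis
      by (cases "k = l")
        (simp_all add: m lookup_add fock_deriv.rep_eq fock_mult.rep_eq add_mset_commute[of k l]
          algebra_simps)
  next
    case False
    then have "count m l = 0" by (simp add: not_in_iff)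
    then show ?thesis
      using False by (simp add: lookup_add fock_deriv.rep_eq fock_mult.rep_eq)
  qed
qed

lemma fock_mult_neg: "fock_mult k (- f) = - fock_mult k f"
  and fock_deriv_neg: "fock_deriv k (- f) = - fock_deriv k f"
  by (transfer, auto)+

lemma fock_vector_space: "vector_space fock_scale"
  by standard (transfer, auto simp: algebra_simps fun_eq_iff)+

lemma linear_fock_mult: "Vector_Spaces.linear fock_scale fock_scale (fock_mult k)"
  unfolding Vector_Spaces.linear_iff
  by (intro conjI fock_vector_space allI) (transfer, auto simp: fun_eq_iff)+

lemma linear_fock_deriv: "Vector_Spaces.linear fock_scale fock_scale (fock_deriv k)"
  unfolding Vector_Spaces.linear_iff
  by (intro conjI fock_vector_space allI) (transfer, auto simp: fun_eq_iff algebra_simps)+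

lemma linear_fock_deriv_neg:
  "Vector_Spaces.linear fock_scale fock_scale (\<lambda>f. - fock_deriv k f)"
  unfolding Vector_Spaces.linear_iff
  by (intro conjI fock_vector_space allI) (transfer, auto simp: fun_eq_iff algebra_simps)+

lemma fock_mult_single:
  "fock_mult k (Poly_Mapping.single m c) = Poly_Mapping.single (add_mset k m) c"
  by (intro poly_mapping_eqI) (auto simp: fock_mult.rep_eq lookup_single when_def)

lemma fock_scale_single:
  "fock_scale c (Poly_Mapping.single m d) = Poly_Mapping.single m (c * d)"
  by (intro poly_mapping_eqI) (auto simp: fock_scale.rep_eq lookup_single when_def)

lemma fock_deriv_vac: "fock_deriv k fock_vac = 0"
  unfolding fock_vac_def
  by (intro poly_mapping_eqI)
    (auto simp: fock_deriv.rep_eq lookup_single when_def simp del: single_one)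

theorem charged_free_bosons_fock:
  "charged_free_bosons (fock_scale :: 'a::field_char_0 \<Rightarrow> 'a fock \<Rightarrow> 'a fock)
    fock_phi fock_phis fock_vac"
proof (intro charged_free_bosons.intro fock_vector_space charged_free_bosons_axioms.intro)
  interpret vector_space "fock_scale :: 'a \<Rightarrow> 'a fock \<Rightarrow> 'a fock"
    by (rule fock_vector_space)
  fix i j :: int
  show "Vector_Spaces.linear fock_scale fock_scale (fock_phi i :: 'a fock \<Rightarrow> _)"
    by (simp add: fock_phi_def linear_fock_mult linear_fock_deriv)
  show "Vector_Spaces.linear fock_scale fock_scale (fock_phis i :: 'a fock \<Rightarrow> _)"
    by (simp add: fock_phis_def linear_fock_mult linear_fock_deriv_neg)
  show "commutator (fock_phi i) (fock_phis j) =
      (\<lambda>v :: 'a fock. fock_scale (if i = - j then 1 else 0) v)"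
    by (auto simp: fun_eq_iff commutator_def fock_phi_def fock_phis_def fock_deriv_mult
        fock_mult_neg fock_deriv_neg fock_mult_mult fock_deriv_deriv)
  show "commutator (fock_phi i) (fock_phi j) = (\<lambda>v :: 'a fock. 0)"
    by (auto simp: fun_eq_iff commutator_def fock_phi_def fock_deriv_mult
        fock_mult_mult fock_deriv_deriv)
  show "commutator (fock_phis i) (fock_phis j) = (\<lambda>v :: 'a fock. 0)"
    by (auto simp: fun_eq_iff commutator_def fock_phis_def fock_deriv_mult fock_mult_neg
        fock_deriv_neg fock_mult_mult fock_deriv_deriv)
  show "(fock_vac :: 'a fock) \<noteq> 0"
    by (simp add: fock_vac_def)
  show "fock_phi i (fock_vac :: 'a fock) = 0" if "i \<ge> 0"
    using that by (simp add: fock_phi_def fock_deriv_vac)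
  show "fock_phis (i + 1) (fock_vac :: 'a fock) = 0" if "i \<ge> 0"
    using that by (simp add: fock_phis_def fock_deriv_vac)
  fix W :: "'a fock set"
  assume W: "subspace W" "fock_vac \<in> W" "\<And>i w. w \<in> W \<Longrightarrow> fock_phi i w \<in> W"
    "\<And>i w. w \<in> W \<Longrightarrow> fock_phis i w \<in> W"
  have mult: "fock_mult k w \<in> W" if "w \<in> W" for k w
  proof (cases "k < 0")
    case True
    then show ?thesis using W(3)[OF that, of k] by (simp add: fock_phi_def)
  next
    case False
    then show ?thesis using W(4)[OF that, of "- k"] by (simp add: fock_phis_def)
  qed
  have *: "Poly_Mapping.single m 1 \<in> W" for m
  proof (induction m)
    case empty
    then show ?case using W(2) unfolding fock_vac_def .
  next
    case (add k m)
    from mult[OF this, of k] show ?case unfolding fock_mult_single .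
  qed
  have single: "Poly_Mapping.single m c \<in> W" for m c
    using subspace_scale[OF W(1) *, of c m] by (simp only: fock_scale_single mult_1_right)
  have "f \<in> W" for f
  proof -
    have "(\<Sum>m\<in>Poly_Mapping.keys f. Poly_Mapping.single m (Poly_Mapping.lookup f m)) = f"
      by (intro poly_mapping_eqI)
        (auto simp: lookup_sum lookup_single when_def in_keys_iff)
    moreover have "(\<Sum>m\<in>Poly_Mapping.keys f. Poly_Mapping.single m (Poly_Mapping.lookup f m)) \<in> W"
      by (intro subspace_sum W(1) single)
    ultimately show ?thesis by simp
  qed
  then show "W = UNIV" by blast
qed

end

theory Submission
  imports Defs
begin

text \<open>
  All operators involved are built from the products \<open>E r s = \<phi> (- r) \<phi>* s\<close>, whose
  commutators are, up to sign, those of matrix units (\<open>bilinear_bilinear\<close>). In these terms the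
  factors of \<open>B*\<close> and of \<open>C*\<close> follow one pattern: both products are
  \<open>exp (x E (r 0) (r 1)) exp (x E (r 1) (r 2)) \<dots>\<close> for an injective sequence of indices \<open>r\<close>,
  descending for \<open>B*\<close> and ascending for \<open>C*\<close>.

  The exponential formulas are proved without comparing exponentials factor by factor. A series
  \<open>T\<close> with constant term 1 is characterised by its logarithmic derivative: in characteristic 0
  the equation \<open>x T' = x F' T\<close> determines the coefficients of \<open>T\<close> recursively, and
  \<open>is_exp F T\<close> states it with the Euler operator \<open>x d/dx\<close>. Three facts make this the right
  notion.
  \<^item> The finite ordered products satisfy such an equation (\<open>is_exp_ordered_product\<close>). Moving a
    derivative \<open>x E (r p) (r (p + 1))\<close> to the front past the factors on its left produces
    \<open>\<Sum>k. (- 1)^(k + 1) x^k E (r (p + 1 - k)) (r (p + 1))\<close>, so the logarithmic derivative of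
    the product is \<open>\<Sum>k. (- 1)^(k + 1) x^k H k\<close> with \<open>H k\<close> the \<open>k\<close>-th diagonal sum.
  \<^item> The equation passes to limits (\<open>is_exp_series_lim\<close>): when the \<open>H k\<close> stabilize pointwise,
    so do the solutions, coefficient by coefficient. As the products are completed to the infinite
    ones, the diagonal sums become \<open>wedge\<close> and \<open>wedge_star\<close>; as \<open>M \<rightarrow> \<infinity>\<close>, these
    become the \<open>h n\<close>.
  \<^item> For commuting coefficients the exponential series solves it (\<open>is_exp_opser_exp\<close>).

  The Heisenberg relation comes from \<open>[h m, \<phi> k] = - \<phi> (m + k)\<close> and
  \<open>[h m, \<phi>* k] = \<phi>* (m + k)\<close>: they turn \<open>[h m, h n]\<close> into a sum of differences
  \<open>a (j + m) - a j\<close> with \<open>a j = \<phi> (m + n - j) \<phi>* j\<close>. On a fixed vector this family is 0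
  for large \<open>j\<close>, while for very negative \<open>j\<close> it is the identity if \<open>m = - n\<close> and 0
  otherwise, whence the central term. The exchange relation then holds for the exponentials of any
  two families with Heisenberg commutation relations (\<open>heisenberg_exp_exp\<close>), again by comparing
  recursions; the factor \<open>1 - x y\<close> is \<open>exp (- \<Sum>n. (x y)^n / n)\<close>.
\<close>

section \<open>Linear operators in characteristic 0\<close>

text \<open>
  The restriction to characteristic 0 is what permits division by the exponents \<open>n\<close>, on which
  all recursions below rest.
\<close>

locale char_0_vector_space = vector_space scale
  for scale :: "'a::field_char_0 \<Rightarrow> 'v::ab_group_add \<Rightarrow> 'v"
begin

abbreviation lin :: "('v \<Rightarrow> 'v) \<Rightarrow> bool"
  where "lin \<equiv> Vector_Spaces.linear scale scale"

lemma lin_add: "lin A \<Longrightarrow> A (v + w) = A v + A w"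
  and lin_scale: "lin A \<Longrightarrow> A (scale c v) = scale c (A v)"
  by (simp_all add: Vector_Spaces.linear_iff)

lemma lin_zero: "lin A \<Longrightarrow> A 0 = 0"
  using lin_scale[of A 0 0] by simp

lemma lin_neg: "lin A \<Longrightarrow> A (- v) = - A v"
  using lin_add[of A v "- v"] lin_zero[of A] by (simp add: eq_neg_iff_add_eq_0 add.commute)

lemma lin_diff: "lin A \<Longrightarrow> A (v - w) = A v - A w"
  using lin_add[of A "v - w" w] by simp

lemma lin_sum: "lin A \<Longrightarrow> A (\<Sum>i\<in>I. f i) = (\<Sum>i\<in>I. A (f i))"
  by (induction I rule: infinite_finite_induct) (simp_all add: lin_add lin_zero)

lemma linI:
  "(\<And>v w. A (v + w) = A v + A w) \<Longrightarrow> (\<And>c v. A (scale c v) = scale c (A v)) \<Longrightarrow> lin A"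
  by (simp add: Vector_Spaces.linear_iff vector_space_axioms)

lemma lin_of_sum: "(\<And>i. i \<in> I \<Longrightarrow> lin (A i)) \<Longrightarrow> lin (\<lambda>v. \<Sum>i\<in>I. A i v)"
  by (rule linI) (simp_all add: lin_add lin_scale sum.distrib scale_sum_right)

lemma lin_comp: "lin A \<Longrightarrow> lin B \<Longrightarrow> lin (\<lambda>v. A (B v))"
  by (rule linI) (simp_all add: lin_add lin_scale)

lemma lin_scaled: "lin A \<Longrightarrow> lin (\<lambda>v. scale c (A v))"
  by (rule linI) (simp_all add: lin_add lin_scale scale_right_distrib mult.commute)

lemma lin_0: "lin (\<lambda>v. 0)"
  by (rule linI) simp_all

lemma lin_id: "lin (\<lambda>v. v)"
  by (rule linI) simp_all

end

section \<open>Algebra of operator series\<close>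

context char_0_vector_space
begin

lemma opser_mult_assoc:
  assumes "\<And>n. lin (F n)"
  shows "opser_mult (opser_mult F G) K = opser_mult F (opser_mult G K)"
proof (intro ext)
  fix n v
  have "opser_mult (opser_mult F G) K n v
      = (\<Sum>k\<le>n. \<Sum>i\<le>k. F i (G (k - i) (K (n - i - (k - i)) v)))"
    unfolding opser_mult_def by (intro sum.cong refl) auto
  also have "\<dots> = (\<Sum>(i, j)\<in>{(i, j). i + j \<le> n}. F i (G j (K (n - i - j) v)))"
    by (rule sum.triangle_reindex_eq[symmetric])
  also have "{(i, j). i + j \<le> n} = (SIGMA i:{..n}. {..n - i})"
    by auto
  also have "(\<Sum>(i, j)\<in>(SIGMA i:{..n}. {..n - i}). F i (G j (K (n - i - j) v)))
      = opser_mult F (opser_mult G K) n v"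
    by (simp add: opser_mult_def sum.Sigma[symmetric] lin_sum[OF assms])
  finally show "opser_mult (opser_mult F G) K n v = opser_mult F (opser_mult G K) n v" .
qed

lemma opser_mult_lin: "(\<And>n. lin (F n)) \<Longrightarrow> (\<And>n. lin (G n)) \<Longrightarrow> lin (opser_mult F G n)"
  unfolding opser_mult_def by (rule lin_of_sum, rule lin_comp)

lemma opser_one_lin: "lin (opser_one n)"
  unfolding opser_one_def by (cases n) (simp_all add: lin_0 lin_id)

lemma opser_power_lin: "(\<And>n. lin (F n)) \<Longrightarrow> lin (opser_power F k n)"
  unfolding opser_power_def
  by (induction k arbitrary: n) (simp_all add: opser_one_lin opser_mult_lin)

lemma opser_exp_lin: "(\<And>n. lin (F n)) \<Longrightarrow> lin (opser_exp scale F n)"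
  unfolding opser_exp_def by (intro lin_of_sum lin_scaled opser_power_lin)

lemma opser_power_Suc: "opser_power F (Suc k) = opser_mult F (opser_power F k)"
  by (simp add: opser_power_def)

lemma opser_power_eq_0:
  assumes "\<And>n. lin (F n)" "\<And>v. F 0 v = 0" "n < k"
  shows "opser_power F k n v = 0"
  using assms(3)
proof (induction k arbitrary: n)
  case (Suc k)
  have "F i (opser_power F k (n - i) v) = 0" if "i \<le> n" for i
    using Suc that assms(2) lin_zero[OF assms(1)] by (cases i) auto
  then show ?case by (simp add: opser_power_Suc opser_mult_def)
qed simp

section \<open>Exponentials as solutions of a differential equation\<close>

text \<open>The operator \<open>x d/dx\<close>, which unlike \<open>d/dx\<close> preserves exponents.\<close>

definition euler :: "'v opser \<Rightarrow> 'v opser"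
  where "euler F = (\<lambda>n v. scale (of_nat n) (F n v))"

lemma euler_mult:
  assumes "\<And>n. lin (F n)"
  shows "euler (opser_mult F G) n v
    = opser_mult (euler F) G n v + opser_mult F (euler G) n v"
proof -
  have "scale (of_nat n) (F k u) = scale (of_nat k) (F k u) + F k (scale (of_nat (n - k)) u)"
    if "k \<le> n" for k u
    using that by (simp add: lin_scale[OF assms] flip: scale_left_distrib of_nat_add del: of_nat_diff)
  then show ?thesis
    by (simp add: euler_def opser_mult_def scale_sum_right flip: sum.distrib)
qed

lemma euler_lin: "(\<And>n. lin (F n)) \<Longrightarrow> lin (euler F n)"
  unfolding euler_def by (intro lin_scaled)

text \<open>
  The equation \<open>x T' = (x F') T\<close> characterises \<open>T = exp F\<close> when the coefficients of
  \<open>F\<close> commute. Without this the solution still exists but need not be the exponential series.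
\<close>

definition is_exp :: "'v opser \<Rightarrow> 'v opser \<Rightarrow> bool"
  where "is_exp F T \<longleftrightarrow> T 0 = id \<and> euler T = opser_mult (euler F) T"

lemma is_exp_rec:
  assumes "is_exp F T"
  shows "T n v = (if n = 0 then v else
    scale (1 / of_nat n) (\<Sum>k\<in>{1..n}. scale (of_nat k) (F k (T (n - k) v))))"
proof (cases "n = 0")
  case False
  have "scale (of_nat n) (T n v) = (\<Sum>k\<le>n. scale (of_nat k) (F k (T (n - k) v)))"
    using fun_cong[OF fun_cong[OF conjunct2[OF assms[unfolded is_exp_def]]], of n v]
    by (simp add: euler_def opser_mult_def)
  also have "\<dots> = (\<Sum>k\<in>{1..n}. scale (of_nat k) (F k (T (n - k) v)))"
    by (intro sum.mono_neutral_right) auto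
  finally have "scale (1 / of_nat n) (\<Sum>k\<in>{1..n}. scale (of_nat k) (F k (T (n - k) v)))
      = scale (1 / of_nat n) (scale (of_nat n) (T n v))" by simp
  with False show ?thesis by simp
qed (use assms in \<open>simp add: is_exp_def\<close>)

text \<open>The equation is a recursion for the coefficients, because \<open>n\<close> is invertible.\<close>

lemma is_exp_unique:
  assumes "is_exp F S" "is_exp F T"
  shows "S = T"
proof (intro ext)
  fix n v
  show "S n v = T n v"
  proof (induction n rule: less_induct)
    case (less n)
    then show ?case
      by (subst is_exp_rec[OF assms(1)], subst is_exp_rec[OF assms(2)])
        (auto intro!: arg_cong[where f = "scale _"] sum.cong)
  qed
qed

lemma is_exp_lin:
  assumes "\<And>n. lin (F n)" "is_exp F T"
  shows "lin (T n)"
proof (induction n rule: less_induct)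
  case (less n)
  have "T n = (\<lambda>v. if n = 0 then v else
      scale (1 / of_nat n) (\<Sum>k\<in>{1..n}. scale (of_nat k) (F k (T (n - k) v))))"
    by (intro ext is_exp_rec assms)
  then show ?case
    using less assms(1)
    by (cases "n = 0") (auto intro!: lin_id lin_scaled lin_of_sum intro: lin_comp[of "F _"])
qed

text \<open>Commutativity enters here: it moves \<open>x F'\<close> to the front of \<open>F^(k + 1)\<close>.\<close>

lemma euler_power:
  assumes lin: "\<And>n. lin (F n)" and comm: "\<And>m n v. F m (F n v) = F n (F m v)"
  shows "euler (opser_power F (Suc k)) n v
    = scale (of_nat (Suc k)) (opser_mult (euler F) (opser_power F k) n v)"
proof (induction k arbitrary: n v)
  case 0
  have *: "opser_power F 0 = opser_one" by (simp add: opser_power_def)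
  have "F i (euler opser_one j v) = 0" for i j
    by (simp add: euler_def opser_one_def lin_zero[OF lin])
  then have "opser_mult F (euler opser_one) n v = 0"
    by (simp add: opser_mult_def)
  then show ?case
    by (simp add: opser_power_Suc * euler_mult[OF lin])
next
  case (Suc k)
  let ?P = "opser_power F k"
  have swap: "opser_mult F (euler F) = opser_mult (euler F) F"
  proof (intro ext)
    fix n v
    have "(\<Sum>k\<le>n. F k (euler F (n - k) v)) = (\<Sum>k\<le>n. F (n - k) (euler F k v))"
      by (rule sum.reindex_bij_witness[of _ "\<lambda>k. n - k" "\<lambda>k. n - k"]) auto
    then show "opser_mult F (euler F) n v = opser_mult (euler F) F n v"
      by (simp add: opser_mult_def euler_def lin_scale[OF lin] comm)
  qed
  have "opser_mult F (euler (opser_power F (Suc k))) n v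
      = scale (of_nat (Suc k)) (opser_mult F (opser_mult (euler F) ?P) n v)"
    by (simp add: opser_mult_def[of F] Suc lin_scale[OF lin] scale_sum_right del: of_nat_Suc)
  also have "opser_mult F (opser_mult (euler F) ?P) = opser_mult (euler F) (opser_power F (Suc k))"
    by (simp add: opser_power_Suc flip: opser_mult_assoc[OF lin] opser_mult_assoc[OF euler_lin, OF lin] swap)
  finally show ?case
    by (subst opser_power_Suc, subst euler_mult[OF lin], subst of_nat_Suc)
      (simp add: scale_left_distrib del: of_nat_Suc)
qed

lemma is_exp_opser_exp:
  assumes lin: "\<And>n. lin (F n)" and comm: "\<And>m n v. F m (F n v) = F n (F m v)"
    and F0: "\<And>v. F 0 v = 0"
  shows "is_exp F (opser_exp scale F)"
  unfolding is_exp_def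
proof (intro conjI ext)
  fix v show "opser_exp scale F 0 v = id v"
    by (simp add: opser_exp_def opser_power_def opser_one_def)
next
  fix n v
  let ?P = "opser_power F"
  \<comment> \<open>The coefficients of \<open>exp F\<close> are sums truncated at their exponent; for exponents below
    \<open>n\<close> they may all be summed up to \<open>n - 1\<close>.\<close>
  have ext: "opser_exp scale F j v = (\<Sum>k<n. scale (1 / fact k) (?P k j v))" if "j < n" for j
    unfolding opser_exp_def using that
    by (intro sum.mono_neutral_left) (auto simp: opser_power_eq_0[OF lin] F0)
  have "euler (opser_exp scale F) n v = (\<Sum>k\<le>n. scale (1 / fact k) (euler (?P k) n v))"
    by (simp add: euler_def opser_exp_def scale_sum_right mult.commute)
  also have "\<dots> = (\<Sum>k<n. scale (1 / fact (Suc k)) (euler (?P (Suc k)) n v))"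
  proof -
    have "euler (?P 0) n v = 0" by (simp add: euler_def opser_power_def opser_one_def)
    then show ?thesis by (simp add: sum.atMost_shift del: fact_Suc)
  qed
  also have "\<dots> = (\<Sum>k<n. scale (1 / fact k) (opser_mult (euler F) (?P k) n v))"
    by (intro sum.cong refl) (simp add: euler_power[OF lin comm] field_simps del: of_nat_Suc)
  also have "\<dots> = (\<Sum>i\<le>n. euler F i (\<Sum>k<n. scale (1 / fact k) (?P k (n - i) v)))"
    by (simp add: opser_mult_def scale_sum_right lin_sum[OF euler_lin, OF lin]
        lin_scale[OF euler_lin, OF lin]) (rule sum.swap)
  also have "\<dots> = opser_mult (euler F) (opser_exp scale F) n v"
    unfolding opser_mult_def
  proof (intro sum.cong refl)
    \<comment> \<open>The truncation at \<open>n - 1\<close> is wrong for the coefficient of exponent \<open>n\<close>, which occurs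
      only at \<open>i = 0\<close>, where \<open>euler F\<close> vanishes.\<close>
    fix i assume "i \<in> {..n}"
    then show "euler F i (\<Sum>k<n. scale (1 / fact k) (?P k (n - i) v))
        = euler F i (opser_exp scale F (n - i) v)"
      by (cases "i = 0") (simp_all add: ext euler_def)
  qed
  finally show "euler (opser_exp scale F) n v = opser_mult (euler F) (opser_exp scale F) n v" .
qed

lemma opser_x_times_lin: "lin X \<Longrightarrow> lin (opser_x_times X n)"
  unfolding opser_x_times_def by (cases "n = 1") (simp_all add: lin_0)

lemma is_exp_x_times:
  assumes "lin X"
  shows "is_exp (opser_x_times X) (opser_exp scale (opser_x_times X))"
  by (rule is_exp_opser_exp[OF opser_x_times_lin[OF assms]])
    (auto simp: opser_x_times_def lin_zero[OF assms])

lemma euler_x_times: "euler (opser_x_times X) = opser_x_times X"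
  by (auto simp: euler_def opser_x_times_def fun_eq_iff)

lemma opser_x_times_mult:
  assumes "lin X"
  shows "opser_mult (opser_x_times X) G 0 v = 0"
    and "opser_mult (opser_x_times X) G (Suc n) v = X (G n v)"
  using opser_mult_x_times[of X G _ v, OF lin_zero[OF assms]] by simp_all

text \<open>
  Since \<open>ad X\<close> sends \<open>W\<close> to \<open>- Z\<close> and kills \<open>Z\<close>, conjugation by
  \<open>exp (x X)\<close> sends \<open>W\<close> to \<open>W - x Z\<close>. This is the coefficient of \<open>x^n\<close> in
  \<open>exp (x X) W = (W - x Z) exp (x X)\<close>.
\<close>

lemma exp_x_times_conjugate:
  assumes lin: "lin X" "lin W" "lin Z"
    and XW: "\<And>v. X (W v) = W (X v) - Z v" and XZ: "\<And>v. X (Z v) = Z (X v)"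
  shows "opser_exp scale (opser_x_times X) n (W v) = W (opser_exp scale (opser_x_times X) n v)
    - (if n = 0 then 0 else Z (opser_exp scale (opser_x_times X) (n - 1) v))"
proof -
  let ?E = "opser_exp scale (opser_x_times X)"
  have E0: "?E 0 v = v" for v
    using is_exp_x_times[OF lin(1)] by (simp add: is_exp_def)
  have E_Suc: "scale (of_nat (Suc n)) (?E (Suc n) v) = X (?E n v)" for n v
    using fun_cong[OF fun_cong[OF conjunct2[OF is_exp_x_times[OF lin(1), unfolded is_exp_def]]], of "Suc n" v]
    unfolding euler_x_times opser_x_times_mult[OF lin(1)] by (simp add: euler_def)
  have E_Z: "?E n (Z v) = Z (?E n v)" for n v
  proof (induction n)
    case (Suc n)
    have "scale (of_nat (Suc n)) (?E (Suc n) (Z v)) = scale (of_nat (Suc n)) (Z (?E (Suc n) v))"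
      by (simp only: E_Suc Suc XZ flip: lin_scale[OF lin(3)])
    then show ?case by (simp del: of_nat_Suc)
  qed (simp add: E0)
  show ?thesis
  proof (induction n)
    case (Suc n)
    have "scale (of_nat (Suc n)) (?E (Suc n) (W v))
        = X (W (?E n v) - (if n = 0 then 0 else Z (?E (n - 1) v)))"
      by (simp only: E_Suc Suc)
    also have "\<dots> = W (X (?E n v)) - Z (?E n v) - (if n = 0 then 0 else Z (X (?E (n - 1) v)))"
      by (simp add: lin_diff[OF lin(1)] lin_zero[OF lin(1)] XW XZ)
    also have "(if n = 0 then 0 else Z (X (?E (n - 1) v))) = scale (of_nat n) (Z (?E n v))"
      by (cases n) (simp_all del: of_nat_Suc flip: E_Suc add: lin_scale[OF lin(3)])
    also have "W (X (?E n v)) - Z (?E n v) - scale (of_nat n) (Z (?E n v))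
        = scale (of_nat (Suc n)) (W (?E (Suc n) v) - Z (?E n v))"
      by (simp add: scale_right_diff_distrib lin_scale[OF lin(2), symmetric] E_Suc del: of_nat_Suc)
        (simp add: scale_left_distrib)
    finally show ?case by (simp del: of_nat_Suc)
  qed (simp add: E0)
qed

lemma euler_log_series:
  "euler (log_series scale H) k v = (if k = 0 then 0 else scale ((- 1) ^ (k + 1)) (H k v))"
  by (simp add: euler_def log_series_def)

lemma log_series_lin: "(\<And>k. k \<noteq> 0 \<Longrightarrow> lin (H k)) \<Longrightarrow> lin (log_series scale H n)"
proof (cases "n = 0")
  case False
  assume "\<And>k. k \<noteq> 0 \<Longrightarrow> lin (H k)"
  with False have "lin (H n)" by simp
  with False show ?thesis
    by (simp only: log_series_def if_False) (rule lin_scaled)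
qed (simp add: log_series_def lin_0)

text \<open>
  Newton's identities: \<open>H k\<close> takes the place of the \<open>k\<close>-th power sum and \<open>T n\<close> that of the
  \<open>n\<close>-th elementary symmetric function.
\<close>

lemma is_exp_log_series:
  assumes "is_exp (log_series scale H) T"
  shows "scale (of_nat n) (T n v) = (\<Sum>k\<in>{1..n}. scale ((- 1) ^ (k + 1)) (H k (T (n - k) v)))"
proof -
  have "scale (of_nat n) (T n v)
      = (\<Sum>k\<le>n. if k = 0 then 0 else scale ((- 1) ^ (k + 1)) (H k (T (n - k) v)))"
    using fun_cong[OF fun_cong[OF conjunct2[OF assms[unfolded is_exp_def]]], of n v]
    unfolding opser_mult_def euler_log_series by (simp add: euler_def)
  also have "\<dots> = (\<Sum>k\<in>{1..n}. scale ((- 1) ^ (k + 1)) (H k (T (n - k) v)))"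
    by (intro sum.mono_neutral_cong_right) auto
  finally show ?thesis .
qed

end

section \<open>Limits\<close>

lemma stable_lim_eq:
  assumes "\<forall>\<^sub>F n in sequentially. f n = l"
  shows "stable_lim f = l"
  unfolding stable_lim_def
proof (rule the_equality[where P = "\<lambda>l. \<forall>\<^sub>F n in sequentially. f n = l", OF assms])
  fix k assume "\<forall>\<^sub>F n in sequentially. f n = k"
  with assms have "\<forall>\<^sub>F n in sequentially. k = l" by eventually_elim auto
  then show "k = l" by simp
qed

lemma stabilizesD: "stabilizes f \<Longrightarrow> \<forall>\<^sub>F n in sequentially. f n = stable_lim f"
  unfolding stabilizes_def using stable_lim_eq by metis

lemma op_limI:
  assumes "\<And>v. \<forall>\<^sub>F n in sequentially. T n v = S v"
  shows "op_stabilizes T" "op_lim T = S"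
  using assms stable_lim_eq[OF assms]
  by (auto simp: op_stabilizes_def stabilizes_def op_lim_def fun_eq_iff)

lemma op_limD: "op_stabilizes T \<Longrightarrow> \<forall>\<^sub>F n in sequentially. T n v = op_lim T v"
  by (simp add: op_stabilizes_def op_lim_def stabilizesD)

lemma series_limI:
  assumes "\<And>k v. \<forall>\<^sub>F n in sequentially. F n k v = G k v"
  shows "series_stabilizes F" "series_lim F = G"
  using op_limI[OF assms] by (auto simp: series_stabilizes_def series_lim_def fun_eq_iff)

lemma eventually_comp:
  assumes "\<forall>\<^sub>F n in sequentially. f n = l" "\<forall>\<^sub>F n in sequentially. T n l = m"
  shows "\<forall>\<^sub>F n in sequentially. T n (f n) = m"
  using assms by eventually_elim simp

lemma eventually_series_lim:
  "series_stabilizes F \<Longrightarrow> \<forall>\<^sub>F n in sequentially. F n k v = series_lim F k v"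
  unfolding series_stabilizes_def series_lim_def by (rule op_limD) blast

lemma opser_mult_xy_lim:
  assumes "series_stabilizes F" "series_stabilizes G"
  shows "series_stabilizes (\<lambda>M. opser_mult_xy (F M) (G M))"
    and "series_lim (\<lambda>M. opser_mult_xy (F M) (G M)) = opser_mult_xy (series_lim F) (series_lim G)"
    and "series_stabilizes (\<lambda>M. opser_mult_yx (G M) (F M))"
    and "series_lim (\<lambda>M. opser_mult_yx (G M) (F M)) = opser_mult_yx (series_lim G) (series_lim F)"
proof -
  have xy: "\<forall>\<^sub>F M in sequentially. opser_mult_xy (F M) (G M) k v
      = opser_mult_xy (series_lim F) (series_lim G) k v" for k :: "nat \<times> nat" and v
    unfolding opser_mult_xy_def case_prod_unfold
    by (rule eventually_comp; rule eventually_series_lim; rule assms)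
  have yx: "\<forall>\<^sub>F M in sequentially. opser_mult_yx (G M) (F M) k v
      = opser_mult_yx (series_lim G) (series_lim F) k v" for k :: "nat \<times> nat" and v
    unfolding opser_mult_yx_def case_prod_unfold
    by (rule eventually_comp; rule eventually_series_lim; rule assms)
  show "series_stabilizes (\<lambda>M. opser_mult_xy (F M) (G M))"
    "series_lim (\<lambda>M. opser_mult_xy (F M) (G M)) = opser_mult_xy (series_lim F) (series_lim G)"
    by (rule series_limI, rule xy)+
  show "series_stabilizes (\<lambda>M. opser_mult_yx (G M) (F M))"
    "series_lim (\<lambda>M. opser_mult_yx (G M) (F M)) = opser_mult_yx (series_lim G) (series_lim F)"
    by (rule series_limI, rule yx)+
qed

context char_0_vector_space
begin

text \<open>
  The coefficient of \<open>x^n\<close> in \<open>T L\<close> is a finite expression in the operators \<open>F L k\<close> with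
  \<open>k \<le> n\<close>, applied to earlier coefficients; once these have stabilized on the given vector,
  the operators stabilize on the resulting one.
\<close>

lemma is_exp_series_lim:
  assumes exps: "\<And>L. is_exp (F L) (T L)"
    and lim: "\<And>k v. k \<noteq> 0 \<Longrightarrow> \<forall>\<^sub>F L in sequentially. F L k v = G k v"
  shows "is_exp G (series_lim T)" "series_stabilizes T"
proof -
  define S where "S n v = stable_lim (\<lambda>L. T L n v)" for n v
  have step: "\<forall>\<^sub>F L in sequentially. T L n v = (if n = 0 then v else
      scale (1 / of_nat n) (\<Sum>k\<in>{1..n}. scale (of_nat k) (G k (S (n - k) v))))"
    if IH: "\<And>m. m < n \<Longrightarrow> \<forall>\<^sub>F L in sequentially. T L m v = S m v" for n v
  proof -
    have "\<forall>\<^sub>F L in sequentially. F L k (T L (n - k) v) = G k (S (n - k) v)" if "k \<in> {1..n}" for k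
      by (rule eventually_comp[OF IH lim]) (use that in auto)
    then have "\<forall>\<^sub>F L in sequentially. \<forall>k\<in>{1..n}. F L k (T L (n - k) v) = G k (S (n - k) v)"
      by (simp add: eventually_ball_finite)
    then show ?thesis
      by eventually_elim (subst is_exp_rec[OF exps], simp)
  qed
  have lim_T: "\<forall>\<^sub>F L in sequentially. T L n v = S n v" for n v
  proof (induction n rule: less_induct)
    case (less n)
    from step[OF this] show ?case
      unfolding S_def by (intro stabilizesD) (auto simp: stabilizes_def)
  qed
  have S_rec: "S n v = (if n = 0 then v else
      scale (1 / of_nat n) (\<Sum>k\<in>{1..n}. scale (of_nat k) (G k (S (n - k) v))))" for n v
    unfolding S_def[of n v] by (rule stable_lim_eq, rule step, rule lim_T)
  have "is_exp G S"
    unfolding is_exp_def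
  proof (intro conjI ext)
    show "S 0 v = id v" for v using S_rec[of 0] by simp
    fix n v
    have "opser_mult (euler G) S n v = (\<Sum>k\<in>{1..n}. scale (of_nat k) (G k (S (n - k) v)))"
      unfolding opser_mult_def euler_def by (intro sum.mono_neutral_right) auto
    then show "euler S n v = opser_mult (euler G) S n v"
      by (cases "n = 0") (simp_all add: euler_def S_rec[of n])
  qed
  then show "is_exp G (series_lim T)" "series_stabilizes T"
    using series_limI[of T S, OF lim_T] by auto
qed

lemma log_series_eventually:
  assumes "\<And>k v. k \<noteq> 0 \<Longrightarrow> \<forall>\<^sub>F L in sequentially. H L k v = G k v"
  shows "k \<noteq> 0 \<Longrightarrow> \<forall>\<^sub>F L in sequentially. log_series scale (H L) k v = log_series scale G k v"
  using assms[of k v] by (auto simp: log_series_def elim: eventually_mono)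

section \<open>Exponentials of Heisenberg operators\<close>

context
  fixes p q :: "nat \<Rightarrow> 'v \<Rightarrow> 'v" and S T :: "'v opser"
  assumes lin_p: "\<And>m. m \<noteq> 0 \<Longrightarrow> lin (p m)" and lin_q: "\<And>n. n \<noteq> 0 \<Longrightarrow> lin (q n)"
    and heisenberg: "\<And>m n v. m \<noteq> 0 \<Longrightarrow> n \<noteq> 0 \<Longrightarrow>
      p m (q n v) = q n (p m v) - (if m = n then scale (of_nat m) v else 0)"
    and exp_p: "is_exp (log_series scale p) T" and exp_q: "is_exp (log_series scale q) S"
begin

text \<open>
  The commutator of \<open>p m\<close> with \<open>\<Sum>n. (- 1)^(n + 1) y^n / n q n\<close> is the scalar
  \<open>(- 1)^m y^m\<close>, so \<open>p m S(y) = S(y) (p m + (- 1)^m y^m)\<close>.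
\<close>

lemma heisenberg_op_exp:
  assumes "m \<noteq> 0"
  shows "p m (S n v) = S n (p m v) + (if m \<le> n then scale ((- 1) ^ m) (S (n - m) v) else 0)"
proof (induction n rule: less_induct)
  case (less n)
  show ?case
  proof (cases "n = 0")
    case True
    then show ?thesis using assms exp_q by (simp add: is_exp_def)
  next
    case False
    let ?c = "\<lambda>k. (- 1 :: 'a) ^ (k + 1)"
    let ?s = "(- 1 :: 'a) ^ m"
    have "scale (of_nat n) (p m (S n v)) = (\<Sum>k\<in>{1..n}. scale (?c k) (p m (q k (S (n - k) v))))"
      by (simp only: lin_scale[OF lin_p, OF assms, symmetric] lin_sum[OF lin_p, OF assms, symmetric]
          is_exp_log_series[OF exp_q])
    also have "\<dots> = (\<Sum>k\<in>{1..n}. scale (?c k) (q k (S (n - k) (p m v)))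
        + (if k \<in> {1..n - m} \<and> m \<le> n then scale ?s (scale (?c k) (q k (S (n - m - k) v))) else 0)
        + (if k = m then scale ?s (scale (of_nat m) (S (n - m) v)) else 0))"
    proof (intro sum.cong refl)
      fix k assume k: "k \<in> {1..n}"
      have "p m (S (n - k) v) = S (n - k) (p m v)
          + (if m \<le> n - k then scale ?s (S (n - k - m) v) else 0)"
        using less[of "n - k"] k by simp
      moreover have "n - k - m = n - m - k" by simp
      moreover have "m \<le> n - k \<longleftrightarrow> k \<in> {1..n - m} \<and> m \<le> n" using k by auto
      ultimately show "scale (?c k) (p m (q k (S (n - k) v))) = scale (?c k) (q k (S (n - k) (p m v)))
        + (if k \<in> {1..n - m} \<and> m \<le> n then scale ?s (scale (?c k) (q k (S (n - m - k) v))) else 0)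
        + (if k = m then scale ?s (scale (of_nat m) (S (n - m) v)) else 0)"
        using k assms heisenberg[of m k "S (n - k) v"]
        by (simp add: lin_add[OF lin_q] lin_scale[OF lin_q] lin_zero[OF lin_q] scale_right_distrib
            scale_right_diff_distrib mult.commute)
    qed
    also have "\<dots> = (\<Sum>k\<in>{1..n}. scale (?c k) (q k (S (n - k) (p m v))))
        + (if m \<le> n then scale ?s (\<Sum>k\<in>{1..n - m}. scale (?c k) (q k (S (n - m - k) v))) else 0)
        + (if m \<le> n then scale ?s (scale (of_nat m) (S (n - m) v)) else 0)"
    proof -
      have "(\<Sum>k\<in>{1..n}. if k \<in> {1..n - m} \<and> m \<le> n
            then scale ?s (scale (?c k) (q k (S (n - m - k) v))) else 0)
          = (if m \<le> n then \<Sum>k\<in>{1..n - m}. scale ?s (scale (?c k) (q k (S (n - m - k) v))) else 0)"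
        by (cases "m \<le> n") (auto intro!: sum.mono_neutral_cong_right)
      moreover have "(\<Sum>k\<in>{1..n}. if k = m then scale ?s (scale (of_nat m) (S (n - m) v)) else 0)
          = (if m \<le> n then scale ?s (scale (of_nat m) (S (n - m) v)) else 0)"
        using assms by auto
      ultimately show ?thesis by (simp only: sum.distrib scale_sum_right)
    qed
    also have "\<dots> = scale (of_nat n)
        (S n (p m v) + (if m \<le> n then scale ?s (S (n - m) v) else 0))"
      unfolding is_exp_log_series[OF exp_q, symmetric]
      by (auto simp: scale_right_distrib of_nat_diff algebra_simps simp flip: scale_left_distrib)
    finally show ?thesis using False by simp
  qed
qed

text \<open>
  \<open>T(x) S(y) = (1 - x y) S(y) T(x)\<close>, by comparing the recursions of both sides in the exponent
  of \<open>x\<close>. On the right, moving \<open>p k\<close> past \<open>S(y)\<close> leaves the error sum \<open>U x y\<close>,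
  which telescopes against \<open>U (x - 1) (y - 1)\<close> coming from the term with \<open>x y\<close>.
\<close>

lemma heisenberg_exp_exp:
  "T x (S y v) = S y (T x v) - (if x = 0 \<or> y = 0 then 0 else S (y - 1) (T (x - 1) v))"
proof (induction x rule: less_induct)
  case (less x)
  let ?c = "\<lambda>k. (- 1 :: 'a) ^ (k + 1)"
  define U where "U x y = (\<Sum>k\<in>{1..x}. if k \<le> y then S (y - k) (T (x - k) v) else 0)" for x y
  have lin_S: "lin (S y)" for y
    by (rule is_exp_lin[OF log_series_lin exp_q]) (rule lin_q)
  have T0: "T 0 v = v" and S0: "S 0 v = v" for v
    using exp_p exp_q by (simp_all add: is_exp_def)
  have sum_p: "(\<Sum>k\<in>{1..x}. scale (?c k) (p k (S y (T (x - k) v)))) = scale (of_nat x) (S y (T x v)) - U x y"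
    for x y
  proof -
    have "(\<Sum>k\<in>{1..x}. scale (?c k) (p k (S y (T (x - k) v))))
        = (\<Sum>k\<in>{1..x}. S y (scale (?c k) (p k (T (x - k) v))) - (if k \<le> y then S (y - k) (T (x - k) v) else 0))"
      by (intro sum.cong refl)
        (auto simp: heisenberg_op_exp scale_right_distrib lin_scale[OF lin_S] lin_neg[OF lin_S] simp flip: power_add)
    then show ?thesis
      by (simp only: sum_subtractf U_def lin_sum[OF lin_S, symmetric]
          is_exp_log_series[OF exp_p, symmetric]) (simp only: lin_scale[OF lin_S])
  qed
  show ?case
  proof (cases "x = 0 \<or> y = 0")
    case True
    then show ?thesis by (auto simp: T0 S0)
  next
    case False
    then obtain x' y' where xy: "x = Suc x'" "y = Suc y'"
      by (metis not0_implies_Suc)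
    \<comment> \<open>What remains of the two error sums is exactly the missing unit in the coefficient
      \<open>x'\<close> of the second term.\<close>
    have U: "U x y = S y' (T x' v) + U x' y'"
      unfolding U_def xy by (subst sum.atLeast_Suc_atMost) (simp_all add: sum.shift_bounds_cl_Suc_ivl del: sum.cl_ivl_Suc cong: if_cong)
    have "scale (of_nat x) (T x (S y v)) = (\<Sum>k\<in>{1..x}. scale (?c k) (p k (T (x - k) (S y v))))"
      by (rule is_exp_log_series[OF exp_p])
    also have "\<dots> = (\<Sum>k\<in>{1..x}. scale (?c k) (p k (S y (T (x - k) v)))
        - (if k = x then 0 else scale (?c k) (p k (S y' (T (x' - k) v)))))"
    proof (intro sum.cong refl)
      fix k assume k: "k \<in> {1..x}"
      then show "scale (?c k) (p k (T (x - k) (S y v))) = scale (?c k) (p k (S y (T (x - k) v)))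
          - (if k = x then 0 else scale (?c k) (p k (S y' (T (x' - k) v))))"
        using less[of "x - k"] by (auto simp: xy lin_diff[OF lin_p] lin_zero[OF lin_p] scale_right_diff_distrib)
    qed
    also have "\<dots> = (\<Sum>k\<in>{1..x}. scale (?c k) (p k (S y (T (x - k) v))))
        - (\<Sum>k\<in>{1..x'}. scale (?c k) (p k (S y' (T (x' - k) v))))"
      unfolding sum_subtractf by (intro arg_cong2[where f = minus] refl sum.mono_neutral_cong_right) (auto simp: xy)
    also have "\<dots> = scale (of_nat x) (S y (T x v) - S y' (T x' v))"
      unfolding sum_p U by (simp add: xy scale_right_diff_distrib scale_left_distrib)
    finally show ?thesis using False by (simp add: xy del: of_nat_Suc)
  qed
qed

end

end

section \<open>Ordered products of exponentials\<close>

context charged_free_bosons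
begin

sublocale char_0_vector_space scale ..

definition bilinear :: "int \<Rightarrow> int \<Rightarrow> 'v \<Rightarrow> 'v"
  where "bilinear r s = phi (- r) \<circ> phis s"

lemma bilinear_lin: "lin (bilinear r s)"
  by (rule linI) (simp_all add: bilinear_def phi_add phis_add phi_scale phis_scale)

lemma phi_lin: "lin (phi i)" and phis_lin: "lin (phis i)"
  by (rule linear_phi, rule linear_phis)

lemma bilinear_bilinear:
  "bilinear r s (bilinear p q v) = bilinear p q (bilinear r s v)
    + (if r = q then bilinear p s v else 0) - (if s = p then bilinear r q v else 0)"
proof -
  have *: "phis s (phi (- p) w) = phi (- p) (phis s w) - (if s = p then w else 0)" for s p w
    using phi_phis[of "- p" s w] by auto
  show ?thesis
    by (simp add: bilinear_def * lin_diff[OF phi_lin] phi_phi[of "- r" "- p"] phis_phis[of s q])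
qed

text \<open>
  The sum over the \<open>k\<close>-th superdiagonal, when \<open>r 0, \<dots>, r L\<close> index rows and columns.
\<close>

definition diagonal :: "(nat \<Rightarrow> int) \<Rightarrow> nat \<Rightarrow> nat \<Rightarrow> 'v \<Rightarrow> 'v"
  where "diagonal r L k = (\<lambda>v. \<Sum>p<Suc L - k. bilinear (r p) (r (p + k)) v)"

lemma diagonal_lin: "lin (diagonal r L k)"
  unfolding diagonal_def by (intro lin_of_sum bilinear_lin)

text \<open>
  Induction on the number of factors, splitting off the leftmost one. Conjugation by
  \<open>exp (x E (r 0) (r 1))\<close> changes only the diagonal sums of the remaining indices that contain
  an entry in row \<open>r 1\<close>, and replaces \<open>E (r 1) (r (k + 1))\<close> by
  \<open>E (r 1) (r (k + 1)) - x E (r 0) (r (k + 1))\<close>. Together with the derivative of the new factor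
  these corrections are the entries in row \<open>r 0\<close> that the larger diagonal sums have in
  addition.
\<close>

lemma is_exp_ordered_product:
  assumes "inj_on r {..L}"
  shows "is_exp (log_series scale (diagonal r L))
    (opser_prod_list (map (\<lambda>p. opser_exp scale (opser_x_times (bilinear (r p) (r (Suc p))))) [0..<L]))"
  using assms
proof (induction L arbitrary: r)
  case 0
  have "opser_mult (euler (log_series scale (diagonal r 0))) opser_one = (\<lambda>n v. 0)"
    by (auto simp: opser_mult_def euler_log_series diagonal_def fun_eq_iff intro!: sum.neutral)
  then show ?case
    by (auto simp: is_exp_def opser_prod_list_def opser_one_def euler_def fun_eq_iff)
next
  case (Suc L)
  define X where "X = bilinear (r 0) (r 1)"
  define E where "E = opser_exp scale (opser_x_times X)"
  define Q where "Q = opser_prod_list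
    (map (\<lambda>p. opser_exp scale (opser_x_times (bilinear (r (Suc p)) (r (Suc (Suc p)))))) [0..<L])"
  define D where "D = euler (log_series scale (diagonal (r \<circ> Suc) L))"
  define D' where "D' = euler (log_series scale (diagonal r (Suc L)))"
  define Z where "Z k v = (if k \<le> Suc L then bilinear (r 0) (r k) v else 0)" for k v
  have inj: "r i = r j \<longleftrightarrow> i = j" if "i \<le> Suc L" "j \<le> Suc L" for i j
    using inj_onD[OF Suc.prems, of i j] that by auto
  have prod: "opser_prod_list
      (map (\<lambda>p. opser_exp scale (opser_x_times (bilinear (r p) (r (Suc p))))) [0..<Suc L])
      = opser_mult E Q"
    unfolding opser_prod_list_def E_def Q_def X_def
    by (simp add: upt_conv_Cons map_Suc_upt[symmetric] comp_def del: upt_Suc)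
  have linX: "lin X" by (simp add: X_def bilinear_lin)
  have linE: "lin (E n)" for n
    unfolding E_def by (rule opser_exp_lin, rule opser_x_times_lin, rule linX)
  have linD': "lin (D' n)" for n
    unfolding D'_def by (rule euler_lin, rule log_series_lin, rule diagonal_lin)
  have linZ: "lin (Z k)" for k
    unfolding Z_def by (cases "k \<le> Suc L") (simp_all add: bilinear_lin lin_0)
  have expE: "is_exp (opser_x_times X) E"
    unfolding E_def by (rule is_exp_x_times[OF linX])
  have "inj_on (r \<circ> Suc) {..L}"
    by (auto simp: inj_on_def inj)
  from Suc.IH[OF this] have expQ: "is_exp (log_series scale (diagonal (r \<circ> Suc) L)) Q"
    by (simp add: Q_def comp_def)
  have diagonal_Suc: "diagonal r (Suc L) k v = diagonal (r \<circ> Suc) L k v + Z k v" for k v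
  proof (cases "k \<le> Suc L")
    case True
    then have "Suc (Suc L) - k = Suc (Suc L - k)" by simp
    with True show ?thesis
      by (simp add: diagonal_def Z_def sum.lessThan_Suc_shift del: sum.lessThan_Suc)
  qed (simp add: diagonal_def Z_def)
  have conj: "E n (diagonal (r \<circ> Suc) L k v) = diagonal (r \<circ> Suc) L k (E n v)
      - (if n = 0 then 0 else Z (Suc k) (E (n - 1) v))" if "k \<noteq> 0" for n k v
    unfolding E_def
  proof (rule exp_x_times_conjugate[OF linX diagonal_lin linZ])
    fix v
    have "X (bilinear (r (Suc p)) (r (Suc (p + k))) v) = bilinear (r (Suc p)) (r (Suc (p + k))) (X v)
        - (if p = 0 then Z (Suc k) v else 0)" if "p < Suc L - k" for p
      using that \<open>k \<noteq> 0\<close>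
      by (cases "p = 0") (simp_all add: X_def bilinear_bilinear[of "r 0"] inj Z_def)
    then have "X (diagonal (r \<circ> Suc) L k v) = diagonal (r \<circ> Suc) L k (X v)
        - (\<Sum>p<Suc L - k. if p = 0 then Z (Suc k) v else 0)"
      unfolding diagonal_def lin_sum[OF linX] sum_subtractf[symmetric]
      by (intro sum.cong refl) simp
    also have "(\<Sum>p<Suc L - k. if p = 0 then Z (Suc k) v else 0) = Z (Suc k) v"
      by (simp add: Z_def)
    finally show "X (diagonal (r \<circ> Suc) L k v) = diagonal (r \<circ> Suc) L k (X v) - Z (Suc k) v" .
    show "X (Z (Suc k) v) = Z (Suc k) (X v)"
      using \<open>k \<noteq> 0\<close> bilinear_bilinear[of "r 0" "r 1" "r 0" "r (Suc k)" v]
      by (simp add: Z_def X_def inj lin_zero[OF bilinear_lin])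
  qed
  \<comment> \<open>\<open>x X E + E D = D' E\<close>: the conjugate of \<open>D\<close>, plus the derivative of the new factor,
    is \<open>D'\<close>.\<close>
  have key: "opser_mult (opser_x_times X) E n v + opser_mult E D n v = opser_mult D' E n v" for n v
  proof (cases n)
    case 0
    then show ?thesis
      using opser_x_times_mult(1)[OF linX]
      by (simp add: opser_mult_def D_def D'_def euler_log_series lin_zero[OF linE] opser_x_times_def)
  next
    case (Suc m)
    let ?c = "\<lambda>k. (- 1 :: 'a) ^ k"
    let ?H = "\<lambda>k. scale (?c k) (diagonal (r \<circ> Suc) L (Suc k) (E (m - k) v))"
    let ?Z = "\<lambda>k. scale (?c k) (Z (Suc k) (E (m - k) v))"
    have "opser_mult E D n v = (\<Sum>k\<le>n. E (n - k) (D k v))"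
      unfolding opser_mult_def
      by (rule sum.reindex_bij_witness[of _ "\<lambda>k. n - k" "\<lambda>k. n - k"]) auto
    also have "\<dots> = (\<Sum>k\<le>m. E (m - k) (D (Suc k) v))"
      unfolding Suc sum.atMost_Suc_shift by (simp add: D_def euler_log_series lin_zero[OF linE])
    also have "\<dots> = (\<Sum>k\<le>m. ?H k + (if k = m then 0 else ?Z (Suc k)))"
      by (intro sum.cong refl)
        (auto simp: D_def euler_log_series lin_scale[OF linE] conj scale_right_diff_distrib)
    also have "\<dots> = (\<Sum>k\<le>m. ?H k) + (\<Sum>k<m. ?Z (Suc k))"
      by (simp add: sum.distrib flip: lessThan_Suc_atMost)
    finally have "X (E m v) + opser_mult E D n v
        = X (E m v) + ((\<Sum>k\<le>m. ?H k) + (\<Sum>k<m. ?Z (Suc k)))"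
      by (rule arg_cong)
    also have "\<dots> = (\<Sum>k\<le>m. ?H k) + (\<Sum>k\<le>m. ?Z k)"
      by (simp add: sum.atMost_shift Z_def X_def)
    also have "\<dots> = (\<Sum>k\<le>m. D' (Suc k) (E (m - k) v))"
      by (simp add: D'_def euler_log_series diagonal_Suc scale_right_distrib sum.distrib)
    also have "\<dots> = opser_mult D' E n v"
      unfolding opser_mult_def Suc sum.atMost_Suc_shift by (simp add: D'_def euler_log_series)
    finally show ?thesis
      by (simp add: Suc opser_x_times_mult[OF linX])
  qed
  show ?case
    unfolding prod is_exp_def
  proof (intro conjI ext)
    show "opser_mult E Q 0 v = id v" for v
      using expE expQ by (simp add: is_exp_def opser_mult_def)
    fix n v
    have "euler (opser_mult E Q) n v
        = opser_mult (opser_mult (opser_x_times X) E) Q n v + opser_mult E (opser_mult D Q) n v"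
      using expE expQ by (simp add: euler_mult[OF linE] is_exp_def euler_x_times D_def)
    also have "\<dots> = opser_mult (opser_mult D' E) Q n v"
      unfolding opser_mult_assoc[OF linE, symmetric]
      unfolding opser_mult_def[of _ Q]
      by (simp only: key flip: sum.distrib)
    finally show "euler (opser_mult E Q) n v
        = opser_mult (euler (log_series scale (diagonal r (Suc L)))) (opser_mult E Q) n v"
      unfolding opser_mult_assoc[OF linD'] unfolding D'_def .
  qed
qed

end

section \<open>The Heisenberg operators as sums of bilinears\<close>

context char_0_vector_space
begin

text \<open>
  Shifting by one step loses the value \<open>c\<close> at the left end and gains 0 at the right end.
\<close>

lemma sum_shift_eventually_constant:
  fixes a :: "int \<Rightarrow> 'v"
  assumes right: "\<And>j. j \<ge> N \<Longrightarrow> a j = 0" and left: "\<And>j. j \<le> - N \<Longrightarrow> a j = c"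
    and "0 \<le> N" "\<bar>m\<bar> + N \<le> K"
  shows "(\<Sum>j\<in>{- K..K}. a (j + m)) = (\<Sum>j\<in>{- K..K}. a j) - scale (of_int m) c"
proof -
  have step: "(\<Sum>j\<in>{- K..K}. a (j + (i + 1))) = (\<Sum>j\<in>{- K..K}. a (j + i)) - c"
    if "\<bar>i\<bar> + N \<le> K" "\<bar>i + 1\<bar> + N \<le> K" for i
  proof -
    have "(\<Sum>j\<in>{- K..K}. a (j + (i + 1))) = (\<Sum>j\<in>{- K + 1..K + 1}. a (j + i))"
      by (rule sum.reindex_bij_witness[of _ "\<lambda>j. j - 1" "\<lambda>j. j + 1"]) (auto simp: algebra_simps)
    also have "\<dots> = (\<Sum>j\<in>{- K + 1..K}. a (j + i)) + a (K + 1 + i)"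
    proof -
      have "{- K + 1..K + 1} = insert (K + 1) {- K + 1..K}" using that \<open>0 \<le> N\<close> by auto
      then show ?thesis by (simp add: add.commute)
    qed
    also have "(\<Sum>j\<in>{- K + 1..K}. a (j + i)) = (\<Sum>j\<in>{- K..K}. a (j + i)) - a (- K + i)"
    proof -
      have "{- K..K} = insert (- K) {- K + 1..K}" using that \<open>0 \<le> N\<close> by auto
      then show ?thesis by simp
    qed
    also have "a (K + 1 + i) = 0" by (rule right) (use that in linarith)
    also have "a (- K + i) = c" by (rule left) (use that in linarith)
    finally show ?thesis by simp
  qed
  show ?thesis
    using assms(4)
  proof (induction m rule: int_induct[where k = 0])
    case base
    then show ?case by simp
  next
    case (step1 i)
    then show ?case
      using step[of i] by (simp add: scale_left_distrib diff_diff_eq add.commute)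
  next
    case (step2 i)
    then have "(\<Sum>j\<in>{- K..K}. a (j + (i - 1))) = (\<Sum>j\<in>{- K..K}. a (j + i)) + c"
      using step[of "i - 1"] by simp
    with step2 show ?case
      by (simp add: scale_left_diff_distrib)
  qed
qed

end

context charged_free_bosons
begin

text \<open>
  The operator \<open>h m\<close> without the cutoff \<open>M\<close>: for \<open>m \<noteq> 0\<close> only finitely many summands
  act nontrivially on a given vector. For \<open>m = 0\<close> the support can be infinite, and the value
  is then the default 0.
\<close>

definition current :: "int \<Rightarrow> 'v \<Rightarrow> 'v"
  where "current m v = Sum_any (\<lambda>j. bilinear (j - m) j v)"

lemma current_eq_sum:
  assumes "m \<noteq> 0"
  shows "\<exists>N. \<forall>K\<ge>N. \<forall>S. finite S \<longrightarrow> {- K..K} \<subseteq> S \<longrightarrow> current m v = (\<Sum>j\<in>S. bilinear (j - m) j v)"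
proof -
  obtain N where N: "\<And>i. i \<ge> N \<Longrightarrow> phi i v = 0 \<and> phis i v = 0"
    using annihilated by blast
  have zero: "bilinear (j - m) j v = 0" if "j \<notin> {- (\<bar>N\<bar> + \<bar>m\<bar>)..\<bar>N\<bar> + \<bar>m\<bar>}" for j
  proof (cases "j \<ge> N")
    case False
    then have "m - j \<ge> N" using that by auto
    then show ?thesis using N[of "m - j"] assms by (simp add: bilinear_def phi_phis)
  qed (simp add: bilinear_def N)
  show ?thesis
  proof (intro exI allI impI)
    fix K S assume "\<bar>N\<bar> + \<bar>m\<bar> \<le> K" "finite S" "{- K..K} \<subseteq> S"
    then have "{j. bilinear (j - m) j v \<noteq> 0} \<subseteq> S"
      using zero by force
    then show "current m v = (\<Sum>j\<in>S. bilinear (j - m) j v)"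
      unfolding current_def using \<open>finite S\<close> by (intro Sum_any.expand_superset)
  qed
qed

lemma current_eventually:
  assumes "m \<noteq> 0"
  shows "\<forall>\<^sub>F K in (at_top :: int filter). current m v = (\<Sum>j\<in>{- K..K}. bilinear (j - m) j v)"
  using current_eq_sum[OF assms, of v] unfolding eventually_at_top_linorder
  by (meson finite_atLeastAtMost_int subset_refl)

lemma current_lin: "lin (current m)" if "m \<noteq> 0"
proof (rule linI)
  fix v w c
  from current_eventually[OF that, of "v + w"] current_eventually[OF that, of v]
    current_eventually[OF that, of w]
  have "\<forall>\<^sub>F K in (at_top :: int filter). current m (v + w) = current m v + current m w"
    by eventually_elim (simp add: lin_add[OF bilinear_lin] sum.distrib)
  then show "current m (v + w) = current m v + current m w" by simp
  from current_eventually[OF that, of "scale c v"] current_eventually[OF that, of v]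
  have "\<forall>\<^sub>F K in (at_top :: int filter). current m (scale c v) = scale c (current m v)"
    by eventually_elim (simp add: lin_scale[OF bilinear_lin] scale_sum_right)
  then show "current m (scale c v) = scale c (current m v)" by simp
qed

lemma current_phi:
  assumes "m \<noteq> 0"
  shows "current m (phi k v) = phi k (current m v) - phi (m + k) v"
proof -
  have summand: "bilinear (j - m) j (phi k v)
      = phi k (bilinear (j - m) j v) - (if j = - k then phi (m + k) v else 0)" for j
  proof -
    have "phis j (phi k v) = phi k (phis j v) - (if j = - k then v else 0)"
      using phi_phis[of k j v] by auto
    then show ?thesis
      by (simp add: bilinear_def lin_diff[OF phi_lin] phi_phi[of "m - j"])
  qed
  from current_eventually[OF assms, of "phi k v"] current_eventually[OF assms, of v]
    eventually_ge_at_top[of "\<bar>k\<bar>"]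
  have "\<forall>\<^sub>F K in (at_top :: int filter). current m (phi k v) = phi k (current m v) - phi (m + k) v"
    by eventually_elim (auto simp: summand sum_subtractf lin_sum[OF phi_lin])
  then show ?thesis by simp
qed

lemma current_phis:
  assumes "m \<noteq> 0"
  shows "current m (phis k v) = phis k (current m v) + phis (m + k) v"
proof -
  have summand: "bilinear (j - m) j (phis k v)
      = phis k (bilinear (j - m) j v) + (if j = m + k then phis (m + k) v else 0)" for j
    using phi_phis[of "m - j" k "phis j v"] by (auto simp: bilinear_def phis_phis[of j k])
  from current_eventually[OF assms, of "phis k v"] current_eventually[OF assms, of v]
    eventually_ge_at_top[of "\<bar>m + k\<bar>"]
  have "\<forall>\<^sub>F K in (at_top :: int filter). current m (phis k v) = phis k (current m v) + phis (m + k) v"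
    by eventually_elim (auto simp: summand sum.distrib lin_sum[OF phis_lin])
  then show ?thesis by simp
qed

text \<open>
  For \<open>m = - n\<close> each of the two sums that formally cancel has infinitely many nonzero terms.
  Cut off symmetrically, they differ by \<open>\<bar>m\<bar>\<close> boundary terms at the negative end, each equal
  to \<open>v\<close>.
\<close>

lemma current_current:
  assumes "m \<noteq> 0" "n \<noteq> 0"
  shows "current m (current n v)
    = current n (current m v) + scale (if m = - n then - of_int m else 0) v"
proof -
  define a where "a j = phi (m + n - j) (phis j v)" for j
  define c where "c = (if m = - n then v else 0)"
  obtain N where N: "\<And>i. i \<ge> N \<Longrightarrow> phi i v = 0 \<and> phis i v = 0"
    using annihilated by blast
  define N' where "N' = \<bar>N\<bar> + \<bar>m\<bar> + \<bar>n\<bar>"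
  have shift: "(\<Sum>j\<in>{- K..K}. a (j + m)) = (\<Sum>j\<in>{- K..K}. a j) - scale (of_int m) c"
    if "\<bar>m\<bar> + N' \<le> K" for K
  proof (rule sum_shift_eventually_constant[OF _ _ _ that])
    show "0 \<le> N'" by (simp add: N'_def)
    fix j :: int
    show "a j = 0" if "j \<ge> N'" using that N[of j] by (simp add: a_def N'_def)
    assume "j \<le> - N'"
    then have "phi (m + n - j) v = 0" using N[of "m + n - j"] by (simp add: N'_def)
    then show "a j = c" by (auto simp: a_def c_def phi_phis)
  qed
  have summand: "current m (bilinear (j - n) j v) = bilinear (j - n) j (current m v) + (a (j + m) - a j)" for j
    by (simp add: bilinear_def current_phi[OF assms(1)] current_phis[OF assms(1)] lin_add[OF phi_lin]
        a_def algebra_simps)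
  from current_eventually[OF assms(2), of v] current_eventually[OF assms(2), of "current m v"]
    eventually_ge_at_top[of "\<bar>m\<bar> + N'"]
  have "\<forall>\<^sub>F K in (at_top :: int filter). current m (current n v) = current n (current m v) - scale (of_int m) c"
    by eventually_elim (simp add: lin_sum[OF current_lin, OF assms(1)] summand sum.distrib sum_subtractf shift)
  then show ?thesis by (simp add: c_def)
qed

lemma wedge_eventually:
  "n \<noteq> 0 \<Longrightarrow> \<forall>\<^sub>F L in sequentially. (\<Sum>i\<in>{- int L..M}. bilinear i (i - n) v) = wedge phi phis n M v"
  using op_limD[OF wedge_partial_stabilizes[of n M], of v]
  by (simp add: wedge_def wedge_partial_def bilinear_def)

lemma wedge_star_eventually:
  "n \<noteq> 0 \<Longrightarrow> \<forall>\<^sub>F L in sequentially. (\<Sum>i\<in>{- int L..M}. bilinear (i - n) i v) = wedge_star phi phis n M v"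
  using op_limD[OF wedge_star_partial_stabilizes[of n M], of v]
  by (simp add: wedge_star_def wedge_star_partial_def bilinear_def)

lemma wedge_lim:
  assumes "n \<noteq> 0"
  shows "\<forall>\<^sub>F M in sequentially. wedge phi phis n (int M) v = current (- n) v"
proof -
  obtain N where N: "\<And>K S. N \<le> K \<Longrightarrow> finite S \<Longrightarrow> {- K..K} \<subseteq> S \<Longrightarrow>
      current (- n) v = (\<Sum>j\<in>S. bilinear (j + n) j v)"
    using current_eq_sum[of "- n" v] assms by auto
  have "wedge phi phis n (int M) v = current (- n) v" if "M \<ge> nat (\<bar>N\<bar> + \<bar>n\<bar>)" for M
  proof -
    from wedge_eventually[OF assms, where M = "int M" and v = v] eventually_ge_at_top[of "nat (\<bar>N\<bar> + \<bar>n\<bar>)"]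
    have "\<forall>\<^sub>F L in sequentially. wedge phi phis n (int M) v = current (- n) v"
    proof eventually_elim
      fix L assume L: "(\<Sum>i\<in>{- int L..int M}. bilinear i (i - n) v) = wedge phi phis n (int M) v"
        "nat (\<bar>N\<bar> + \<bar>n\<bar>) \<le> L"
      have "(\<Sum>i\<in>{- int L..int M}. bilinear i (i - n) v)
          = (\<Sum>j\<in>{- int L - n..int M - n}. bilinear (j + n) j v)"
        by (rule sum.reindex_bij_witness[of _ "\<lambda>j. j + n" "\<lambda>j. j - n"]) auto
      also have "\<dots> = current (- n) v"
        by (rule N[symmetric, of "\<bar>N\<bar>"]) (use L(2) that in auto)
      finally show "wedge phi phis n (int M) v = current (- n) v" using L(1) by simp
    qed
    then show ?thesis by simp
  qed
  then show ?thesis unfolding eventually_sequentially by blast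
qed

lemma wedge_star_lim:
  assumes "n \<noteq> 0"
  shows "\<forall>\<^sub>F M in sequentially. wedge_star phi phis n (int M) v = current n v"
proof -
  obtain N where N: "\<And>K S. N \<le> K \<Longrightarrow> finite S \<Longrightarrow> {- K..K} \<subseteq> S \<Longrightarrow>
      current n v = (\<Sum>j\<in>S. bilinear (j - n) j v)"
    using current_eq_sum[of n v] assms by auto
  have "wedge_star phi phis n (int M) v = current n v" if "M \<ge> nat \<bar>N\<bar>" for M
  proof -
    from wedge_star_eventually[OF assms, where M = "int M" and v = v] eventually_ge_at_top[of "nat \<bar>N\<bar>"]
    have "\<forall>\<^sub>F L in sequentially. wedge_star phi phis n (int M) v = current n v"
    proof eventually_elim
      fix L assume L: "(\<Sum>i\<in>{- int L..int M}. bilinear (i - n) i v) = wedge_star phi phis n (int M) v"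
        "nat \<bar>N\<bar> \<le> L"
      have "current n v = (\<Sum>j\<in>{- int L..int M}. bilinear (j - n) j v)"
        by (rule N[of "\<bar>N\<bar>"]) (use L(2) that in auto)
      then show "wedge_star phi phis n (int M) v = current n v" using L(1) by simp
    qed
    then show ?thesis by simp
  qed
  then show ?thesis unfolding eventually_sequentially by blast
qed

lemma h_op_eq_current: "h_op phi phis m = current m" if "m \<noteq> 0"
proof (cases "m < 0")
  case True
  with op_limI(2)[OF wedge_lim[of "- m"]] show ?thesis by (simp add: h_op_def)
next
  case False
  with that op_limI(2)[OF wedge_star_lim[of m]] show ?thesis by (simp add: h_op_def)
qed

lemma h_op_lin: "m \<noteq> 0 \<Longrightarrow> lin (h_op phi phis m)"
  by (simp add: h_op_eq_current current_lin)

lemma h_op_h_op: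
  assumes "m \<noteq> 0" "n \<noteq> 0"
  shows "h_op phi phis m (h_op phi phis n v)
    = h_op phi phis n (h_op phi phis m v) + scale (if m = - n then - of_int m else 0) v"
  using current_current[OF assms] by (simp add: h_op_eq_current assms)

lemma h_op_commutator:
  "m \<noteq> 0 \<Longrightarrow> n \<noteq> 0 \<Longrightarrow>
    commutator (h_op phi phis m) (h_op phi phis n) = (\<lambda>v. scale (if m = - n then - of_int m else 0) v)"
  by (simp add: commutator_def h_op_h_op[of m n])

end

section \<open>The limits of the ordered products\<close>

context charged_free_bosons
begin

text \<open>
  The \<open>k\<close>-th diagonal sum for \<open>L\<close> factors runs over \<open>M - L + k \<le> i \<le> M\<close>, which for
  large \<open>L\<close> contains all \<open>i \<le> M\<close> whose summand does not kill \<open>v\<close>.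
\<close>

lemma diagonal_B_star:
  assumes "k \<noteq> 0"
  shows "\<forall>\<^sub>F L in sequentially. diagonal (\<lambda>p. M - int p) L k v = wedge phi phis (int k) M v"
proof -
  from wedge_eventually[where n = "int k" and M = M and v = v] assms obtain N where
    N: "\<And>L. L \<ge> N \<Longrightarrow> (\<Sum>i\<in>{- int L..M}. bilinear i (i - int k) v) = wedge phi phis (int k) M v"
    unfolding eventually_sequentially by auto
  have "diagonal (\<lambda>p. M - int p) L k v = wedge phi phis (int k) M v" if "L \<ge> N + k + nat \<bar>M\<bar>" for L
  proof -
    have L: "int (nat (int L - int k - M)) = int L - int k - M"
      using that by linarith
    have "diagonal (\<lambda>p. M - int p) L k v
        = (\<Sum>i\<in>{- int (nat (int L - int k - M))..M}. bilinear i (i - int k) v)"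
      unfolding diagonal_def L
      by (rule sum.reindex_bij_witness[of _ "\<lambda>i. nat (M - i)" "\<lambda>p. M - int p"])
        (use that in \<open>auto simp: algebra_simps nat_less_iff of_nat_diff\<close>)
    also have "\<dots> = wedge phi phis (int k) M v"
      by (rule N) (use that in linarith)
    finally show ?thesis .
  qed
  then show ?thesis unfolding eventually_sequentially by blast
qed

lemma diagonal_C_star:
  assumes "k \<noteq> 0"
  shows "\<forall>\<^sub>F L in sequentially.
    diagonal (\<lambda>p. M - int L + int p) L k v = wedge_star phi phis (int k) M v"
proof -
  from wedge_star_eventually[where n = "int k" and M = M and v = v] assms obtain N where
    N: "\<And>L. L \<ge> N \<Longrightarrow> (\<Sum>i\<in>{- int L..M}. bilinear (i - int k) i v) = wedge_star phi phis (int k) M v"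
    unfolding eventually_sequentially by auto
  have "diagonal (\<lambda>p. M - int L + int p) L k v = wedge_star phi phis (int k) M v"
    if "L \<ge> N + k + nat \<bar>M\<bar>" for L
  proof -
    have L: "int (nat (int L - int k - M)) = int L - int k - M"
      using that by linarith
    have "diagonal (\<lambda>p. M - int L + int p) L k v
        = (\<Sum>i\<in>{- int (nat (int L - int k - M))..M}. bilinear (i - int k) i v)"
      unfolding diagonal_def L
      by (rule sum.reindex_bij_witness[of _ "\<lambda>i. nat (i - M + int L - int k)" "\<lambda>p. M - int L + int p + int k"])
        (use that in \<open>auto simp: algebra_simps nat_less_iff of_nat_diff\<close>)
    also have "\<dots> = wedge_star phi phis (int k) M v"
      by (rule N) (use that in linarith)
    finally show ?thesis .
  qed
  then show ?thesis unfolding eventually_sequentially by blast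
qed

lemma is_exp_B_star:
  "is_exp (log_series scale (\<lambda>k. wedge phi phis (int k) M)) (B_star scale phi phis M)"
proof -
  have "is_exp (log_series scale (diagonal (\<lambda>p. M - int p) L)) (B_star_partial scale phi phis M L)" for L
    using is_exp_ordered_product[of "\<lambda>p. M - int p" L]
    by (simp add: B_star_partial_def bilinear_def inj_on_def algebra_simps comp_def)
  then show ?thesis
    unfolding B_star_def by (rule is_exp_series_lim) (rule log_series_eventually, rule diagonal_B_star)
qed

lemma is_exp_C_star:
  "is_exp (log_series scale (\<lambda>k. wedge_star phi phis (int k) M)) (C_star scale phi phis M)"
proof -
  have "is_exp (log_series scale (diagonal (\<lambda>p. M - int L + int p) L)) (C_star_partial scale phi phis M L)" for L
  proof -
    \<comment> \<open>The leftmost factor has the smallest index \<open>M - L + 1\<close>, so the ascending sequence depends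
      on the number of factors.\<close>
    have "C_star_partial scale phi phis M L = opser_prod_list (map (\<lambda>p. opser_exp scale (opser_x_times
        (bilinear (M - int L + int p) (M - int L + int (Suc p))))) [0..<L])"
      unfolding C_star_partial_def Let_def bilinear_def
      by (intro arg_cong[where f = opser_prod_list] nth_equalityI)
        (auto simp: rev_nth of_nat_diff algebra_simps)
    then show ?thesis
      using is_exp_ordered_product[of "\<lambda>p. M - int L + int p" L] by (simp add: inj_on_def)
  qed
  then show ?thesis
    unfolding C_star_def by (rule is_exp_series_lim) (rule log_series_eventually, rule diagonal_C_star)
qed

lemma B_star_lim:
  shows "series_stabilizes (\<lambda>M. B_star scale phi phis (int M))"
    and "is_exp (log_series scale (\<lambda>n. h_op phi phis (- int n))) (series_lim (\<lambda>M. B_star scale phi phis (int M)))"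
proof -
  have "\<forall>\<^sub>F M in sequentially. wedge phi phis (int k) (int M) v = h_op phi phis (- int k) v"
    if "k \<noteq> 0" for k v
    using wedge_lim[of "int k" v] that by (simp add: h_op_eq_current)
  note lim = is_exp_series_lim[OF is_exp_B_star log_series_eventually, OF this]
  show "series_stabilizes (\<lambda>M. B_star scale phi phis (int M))"
    by (rule lim(2))
  show "is_exp (log_series scale (\<lambda>n. h_op phi phis (- int n))) (series_lim (\<lambda>M. B_star scale phi phis (int M)))"
    by (rule lim(1))
qed

lemma C_star_lim:
  shows "series_stabilizes (\<lambda>M. C_star scale phi phis (int M))"
    and "is_exp (log_series scale (\<lambda>n. h_op phi phis (int n))) (series_lim (\<lambda>M. C_star scale phi phis (int M)))"
proof -
  have "\<forall>\<^sub>F M in sequentially. wedge_star phi phis (int k) (int M) v = h_op phi phis (int k) v"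
    if "k \<noteq> 0" for k v
    using wedge_star_lim[of "int k" v] that by (simp add: h_op_eq_current)
  note lim = is_exp_series_lim[OF is_exp_C_star log_series_eventually, OF this]
  show "series_stabilizes (\<lambda>M. C_star scale phi phis (int M))"
    by (rule lim(2))
  show "is_exp (log_series scale (\<lambda>n. h_op phi phis (int n))) (series_lim (\<lambda>M. C_star scale phi phis (int M)))"
    by (rule lim(1))
qed

text \<open>
  The factor \<open>c\<close>, which is \<open>- 1\<close> for \<open>B*\<close> and \<open>1\<close> for \<open>C*\<close>, keeps all
  indices of one sign, so that no two of them are opposite and the operators commute.
\<close>

lemma is_exp_log_series_h_op:
  assumes "c \<noteq> 0"
  shows "is_exp (log_series scale (\<lambda>n. h_op phi phis (c * int n)))
    (opser_exp scale (log_series scale (\<lambda>n. h_op phi phis (c * int n))))"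
proof (rule is_exp_opser_exp)
  let ?F = "log_series scale (\<lambda>n. h_op phi phis (c * int n))"
  show "lin (?F n)" for n
    by (rule log_series_lin) (simp add: h_op_lin assms)
  show "?F 0 v = 0" for v
    by (simp add: log_series_def)
  show "?F m (?F n v) = ?F n (?F m v)" for m n v
  proof (cases "m = 0 \<or> n = 0")
    case True
    then show ?thesis
      by (auto simp: log_series_def h_op_lin lin_zero assms)
  next
    case False
    then have "c * int m \<noteq> - (c * int n)"
      using assms by (simp flip: distrib_left add: add_eq_0_iff2[symmetric])
    with False show ?thesis
      using h_op_h_op[of "c * int m" "c * int n" v] assms
      by (simp add: log_series_def lin_scale[OF h_op_lin] lin_neg[OF h_op_lin] mult.commute)
  qed
qed

end

theorem proposition3p3:
  fixes scale :: "'a::field_char_0 \<Rightarrow> 'v::ab_group_add \<Rightarrow> 'v"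
    and phi phis :: "int \<Rightarrow> 'v \<Rightarrow> 'v" and vac :: 'v
  assumes "charged_free_bosons scale phi phis vac"
  shows
    "(\<forall>n::int. n \<ge> 1 \<longrightarrow> op_stabilizes (\<lambda>M. wedge phi phis n (int M))) \<and>
     (\<forall>n::int. n \<ge> 1 \<longrightarrow> op_stabilizes (\<lambda>M. wedge_star phi phis n (int M))) \<and>
     (\<forall>m n :: int. m \<noteq> 0 \<longrightarrow> n \<noteq> 0 \<longrightarrow>
        commutator (h_op phi phis m) (h_op phi phis n) =
          (\<lambda>v. scale (if m = - n then - of_int m else 0) v)) \<and>
     series_stabilizes (\<lambda>M. B_star scale phi phis (int M)) \<and>
     series_lim (\<lambda>M. B_star scale phi phis (int M)) =
       opser_exp scale (log_series scale (\<lambda>n. h_op phi phis (- int n))) \<and>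
     series_stabilizes (\<lambda>M. C_star scale phi phis (int M)) \<and>
     series_lim (\<lambda>M. C_star scale phi phis (int M)) =
       opser_exp scale (log_series scale (\<lambda>n. h_op phi phis (int n))) \<and>
     series_stabilizes (\<lambda>M. opser_mult_xy
       (C_star scale phi phis (int M)) (B_star scale phi phis (int M))) \<and>
     series_stabilizes (\<lambda>M. opser_mult_yx
       (B_star scale phi phis (int M)) (C_star scale phi phis (int M))) \<and>
     series_lim (\<lambda>M. opser_mult_xy
       (C_star scale phi phis (int M)) (B_star scale phi phis (int M))) =
     one_minus_xy_times (series_lim (\<lambda>M. opser_mult_yx
       (B_star scale phi phis (int M)) (C_star scale phi phis (int M))))"
proof -
  interpret charged_free_bosons scale phi phis vac by (rule assms)
  let ?B = "\<lambda>M. B_star scale phi phis (int M)" and ?C = "\<lambda>M. C_star scale phi phis (int M)"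
  let ?h = "h_op phi phis"
  have wedge: "op_stabilizes (\<lambda>M. wedge phi phis n (int M))" if "n \<ge> 1" for n
    by (rule op_limI(1)[OF wedge_lim]) (use that in simp)
  have wedge_star: "op_stabilizes (\<lambda>M. wedge_star phi phis n (int M))" if "n \<ge> 1" for n
    by (rule op_limI(1)[OF wedge_star_lim]) (use that in simp)
  have B: "series_lim ?B = opser_exp scale (log_series scale (\<lambda>n. ?h (- int n)))"
    using is_exp_unique[OF B_star_lim(2)] is_exp_log_series_h_op[of "- 1"] by simp
  have C: "series_lim ?C = opser_exp scale (log_series scale (\<lambda>n. ?h (int n)))"
    using is_exp_unique[OF C_star_lim(2)] is_exp_log_series_h_op[of 1] by simp
  have heisenberg: "?h (int m) (?h (- int n) v)
      = ?h (- int n) (?h (int m) v) - (if m = n then scale (of_nat m) v else 0)"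
    if "m \<noteq> 0" "n \<noteq> 0" for m n v
    using h_op_h_op[of "int m" "- int n" v] that by simp
  have "series_lim ?C x (series_lim ?B y v) = series_lim ?B y (series_lim ?C x v)
      - (if x = 0 \<or> y = 0 then 0 else series_lim ?B (y - 1) (series_lim ?C (x - 1) v))" for x y v
    by (rule heisenberg_exp_exp[OF _ _ heisenberg C_star_lim(2) B_star_lim(2)]) (simp_all add: h_op_lin)
  then have "opser_mult_xy (series_lim ?C) (series_lim ?B)
      = one_minus_xy_times (opser_mult_yx (series_lim ?B) (series_lim ?C))"
    by (auto simp: fun_eq_iff opser_mult_xy_def opser_mult_yx_def one_minus_xy_times_def)
  with opser_mult_xy_lim[OF C_star_lim(1) B_star_lim(1)] show ?thesis
    using wedge wedge_star h_op_commutator B_star_lim(1) C_star_lim(1) B C by simp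
qed

end
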